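(* Let $p\geq 2$ and suppose that the sequence $f_n=n^pa_n$ ($n=0,1,2,\ldots$) satisfies the Hausdorff-type condition: there exist constants $M>0$ and $\epsilon>0$ with $$(n+1)^{(1+\epsilon)}\sum_{i=0}^n \binom{n}{i}^{(2+\epsilon)} \left|\Delta^i f_{n-i}\right|^{(2+\epsilon)} < M \qquad (n=0,1,2,\ldots).$$ Then: (i) the series $$\frac{1}{4\pi}\sum_{n=0}^\infty(2n+1)\,a_n\,P_n(\cos u)\qquad(u\in\mathbb{R})$$ converges uniformly to an analytic function $\underline{f}(\cos u)$ in any compact domain $|\cos u|\leq|\cos u_0|<1$; and (ii) the function $\underline{f}(\cos u)$ admits a holomorphic extension to the complex $\cos\theta$-plane ($\theta=u+iv$, $u,v\in\mathbb{R}$) cut along the axis $[1,+\infty)$.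
   Context: $P_n$ denotes the Legendre polynomials. $\Delta$ is the difference operator $\Delta f_n=f_{n+1}-f_n$, with $\Delta^0$ the identity and $\Delta^k f_n=\sum_{m=0}^k(-1)^m\binom{k}{m}f_{n+k-m}$; the numbers $f_n$ are real. *)

theory Defs
  imports "HOL-Analysis.Analysis"
begin

text \<open>Rodrigues' formula: \<open>P\<^sub>n\<close> is the \<open>n\<close>-th derivative of \<open>(x\<^sup>2 - 1)\<^sup>n\<close>,
  divided by \<open>2\<^sup>n n!\<close>.\<close>

definition Legendre_poly :: "nat \<Rightarrow> real poly" where
  "Legendre_poly n = smult (1 / (2 ^ n * fact n)) ((pderiv ^^ n) ([:-1, 0, 1:] ^ n))"

definition fwd_diff :: "(nat \<Rightarrow> real) \<Rightarrow> nat \<Rightarrow> real" where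
  "fwd_diff f n = f (n + 1) - f n"

lemma fwd_diff_funpow:
  "(fwd_diff ^^ k) f n = (\<Sum>m\<le>k. (-1) ^ m * real (k choose m) * f (n + k - m))"
proof (induction k arbitrary: n)
  case 0
  show ?case by simp
next
  case (Suc k)
  define g where "g m = f (n + Suc k - m)" for m
  have tail: "(\<Sum>m\<le>k. (-1) ^ m * real (k choose m) * g m) =
      g 0 - (\<Sum>m\<le>k. (-1) ^ m * real (k choose Suc m) * g (Suc m))"
    using sum.atMost_Suc_shift[of "\<lambda>m. (-1) ^ m * real (k choose m) * g m" k]
    by (simp add: sum_negf binomial_eq_0)
  have "(fwd_diff ^^ Suc k) f n =
      (\<Sum>m\<le>k. (-1) ^ m * real (k choose m) * g m) -
      (\<Sum>m\<le>k. (-1) ^ m * real (k choose m) * g (Suc m))"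
    by (simp add: fwd_diff_def Suc.IH g_def)
  also have "\<dots> = g 0 - (\<Sum>m\<le>k. (-1) ^ m * real (Suc k choose Suc m) * g (Suc m))"
    unfolding tail by (simp add: sum.distrib algebra_simps)
  also have "\<dots> = (\<Sum>m\<le>Suc k. (-1) ^ m * real (Suc k choose m) * g m)"
    by (subst sum.atMost_Suc_shift) (simp add: sum_negf del: binomial_Suc_Suc)
  finally show ?case by (simp add: g_def)
qed

text \<open>The library's \<open>analytic_on\<close> is restricted to functions on the complex numbers; for functions
  of a real variable, analyticity means having a convergent power series expansion about every
  point of \<open>S\<close>.\<close>

definition real_analytic_on :: "(real \<Rightarrow> real) \<Rightarrow> real set \<Rightarrow> bool" where
  "real_analytic_on f S \<longleftrightarrow> (\<forall>x\<in>S. \<exists>F. (\<lambda>h. f (x + h)) has_fps_expansion F)"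

end

theory Submission
  imports Defs "HOL-Complex_Analysis.Complex_Analysis" "HOL-Real_Asymp.Real_Asymp"
begin

text \<open>
  The idea is to represent the coefficients as moments \<open>a\<^sub>n\<^sub>+\<^sub>1 = \<integral> y\<^sup>n d\<nu>(y)\<close> of a finite signed
  measure on \<open>[0, 1]\<close> and to sum the Legendre series under the integral. The weighted generating
  function \<open>\<Sum> (2 n + 1) P\<^sub>n(z) y\<^sup>n = (1 - y\<^sup>2) / (1 - 2 y z + y\<^sup>2) powr (3/2)\<close> is holomorphic in
  \<open>z\<close> off the cut \<open>[1, \<infinity>)\<close> for every \<open>y \<in> [0, 1]\<close>, since the radicand is a nonpositive real only when
  \<open>z\<close> lies on the cut. Integrating it against \<open>\<nu>\<close> gives the holomorphic extension.

  The measure is never constructed: only its functional on polynomials is used, with bounds in the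
  supremum norm (\<open>bounded_moments\<close>). By Hoelder's inequality, here in the cruder form
  \<open>sum_le_1_plus_power_sum\<close>, the difference condition bounds the total variation of Hausdorff's
  discrete measures, which makes \<open>f\<close> such a moment sequence
  (\<open>bounded_moments_if_differences_bounded\<close>). So is \<open>(n + 1)\<^sup>-\<^sup>p\<close>, by the Gamma integral
  (\<open>bounded_moments_powr\<close>), and products of moment sequences are moment sequences
  (\<open>bounded_moments_mult\<close>); hence so is \<open>a\<^sub>n\<^sub>+\<^sub>1\<close>. The integral of a continuous function is obtained as the
  limit of the functional on Bernstein polynomials; for a kernel that is holomorphic in a parameter this limit
  is holomorphic by Montel's theorem (\<open>Bernstein_sum_holomorphic_limit\<close>), and on power series it can be
  computed termwise (\<open>Bernstein_sum_power_series_tendsto\<close>).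

  The term of index \<open>i = 0\<close> in the difference condition shows moreover that \<open>f\<^sub>n\<close> decays like a negative power
  of \<open>n\<close>, so \<open>\<Sum> (2 n + 1) \<bar>a\<^sub>n\<bar>\<close> converges already for \<open>p = 2\<close>. With \<open>\<bar>P\<^sub>n\<bar> \<le> 1\<close> the Weierstrass
  test yields the uniform convergence. The facts on Legendre polynomials, namely this bound and Bonnet's recurrence
  leading to the generating function, both come from Laplace's integral
  (\<open>Legendre_poly_Laplace_integral\<close>), which is Rodrigues' formula read through Cauchy's formula. Analyticity
  on the interval is inherited from the extension.
\<close>

section \<open>Bounded moment functionals\<close>

definition moment :: "(nat \<Rightarrow> real) \<Rightarrow> real poly \<Rightarrow> real" where
  "moment u p = (\<Sum>j\<le>degree p. coeff p j * u j)"

text \<open>Boundedness for the supremum norm on the unit interval. By the Riesz representation theorem it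
  says that \<open>u\<close> is the moment sequence of a finite signed measure on \<open>[0, 1]\<close>; phrasing it through
  polynomials avoids constructing that measure.\<close>

definition bounded_moments :: "(nat \<Rightarrow> real) \<Rightarrow> bool" where
  "bounded_moments u \<longleftrightarrow>
     (\<exists>C. \<forall>p B. (\<forall>x\<in>{0..1}. \<bar>poly p x\<bar> \<le> B) \<longrightarrow> \<bar>moment u p\<bar> \<le> C * B)"

lemma bounded_momentsE:
  assumes "bounded_moments u"
  obtains C where "C \<ge> 0"
    and "\<And>p B. (\<And>x. x \<in> {0..1} \<Longrightarrow> \<bar>poly p x\<bar> \<le> B) \<Longrightarrow> \<bar>moment u p\<bar> \<le> C * B"
proof -
  from assms obtain C
    where C: "\<And>p B. (\<forall>x\<in>{0..1}. \<bar>poly p x\<bar> \<le> B) \<Longrightarrow> \<bar>moment u p\<bar> \<le> C * B"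
    unfolding bounded_moments_def by blast
  have "0 \<le> \<bar>moment u 1\<bar>" by simp
  also have "\<dots> \<le> C * 1" by (rule C) simp
  finally have "C \<ge> 0" by simp
  with C show thesis by (intro that[of C]) auto
qed

lemma moment_altdef:
  assumes "degree p \<le> n"
  shows "moment u p = (\<Sum>j\<le>n. coeff p j * u j)"
  unfolding moment_def using assms
  by (intro sum.mono_neutral_left) (auto simp: coeff_eq_0)

lemma moment_add: "moment u (p + q) = moment u p + moment u q"
proof -
  define n where "n = max (degree p) (degree q)"
  have "degree p \<le> n" "degree q \<le> n" "degree (p + q) \<le> n"
    by (auto simp: n_def degree_add_le)
  then show ?thesis
    by (simp add: moment_altdef[of _ n] algebra_simps sum.distrib)
qed

lemma moment_smult: "moment u (smult c p) = c * moment u p"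
  by (subst moment_altdef[of _ "degree p"])
     (auto simp: moment_def degree_smult_le sum_distrib_left mult_ac)

lemma moment_0 [simp]: "moment u 0 = 0"
  by (simp add: moment_def)

lemma moment_diff: "moment u (p - q) = moment u p - moment u q"
  using moment_add[of u p "smult (-1) q"] moment_smult[of u "-1" q] by simp

lemma moment_sum: "moment u (sum p A) = (\<Sum>i\<in>A. moment u (p i))"
  by (induction A rule: infinite_finite_induct) (simp_all add: moment_add)

lemma moment_pCons: "moment u (pCons c p) = c * u 0 + moment (\<lambda>n. u (Suc n)) p"
proof -
  have "moment u (pCons c p) = (\<Sum>j\<le>Suc (degree p). coeff (pCons c p) j * u j)"
    by (rule moment_altdef) (rule degree_pCons_le)
  then show ?thesis
    by (subst (asm) sum.atMost_Suc_shift) (simp add: moment_def)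
qed

lemma moment_monom: "moment u (monom c n) = c * u n"
proof -
  have "moment u (monom c n) = (\<Sum>j\<le>n. coeff (monom c n) j * u j)"
    by (rule moment_altdef) (rule degree_monom_le)
  also have "\<dots> = (\<Sum>j\<le>n. if j = n then c * u n else 0)"
    by (rule sum.cong) (auto simp: coeff_monom)
  finally show ?thesis by simp
qed

lemma moment_X_power: "moment u ([:0, 1:] ^ k * q) = moment (\<lambda>n. u (n + k)) q"
proof (induction k arbitrary: u)
  case (Suc k)
  have "moment u ([:0, 1:] ^ Suc k * q) = moment (\<lambda>n. u (Suc n)) ([:0, 1:] ^ k * q)"
    by (simp add: moment_pCons mult.assoc)
  then show ?case by (simp add: Suc.IH)
qed simp

lemma fwd_diff_shift: "(fwd_diff ^^ i) (\<lambda>n. u (n + k)) m = (fwd_diff ^^ i) u (m + k)"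
  by (induction i arbitrary: m) (auto simp: fwd_diff_def)

text \<open>Multiplication by \<open>1 - X\<close> turns into \<open>-\<Delta>\<close> on the sequence, because multiplication by \<open>X\<close> turns
  into the shift.\<close>

lemma moment_1_minus_X_power:
  "moment u ([:1, -1:] ^ i) = (-1) ^ i * (fwd_diff ^^ i) u 0"
proof (induction i arbitrary: u)
  case 0
  show ?case by (simp add: moment_def)
next
  case (Suc i)
  have "moment u ([:1, -1:] ^ Suc i)
      = moment u ([:1, -1:] ^ i) - moment u ([:0, 1:] ^ 1 * [:1, -1:] ^ i)"
    unfolding moment_diff[symmetric]
    by (rule arg_cong[of _ _ "moment u"]) (simp add: poly_eq_poly_eq_iff[symmetric] fun_eq_iff algebra_simps)
  also have "\<dots> = (-1) ^ i * ((fwd_diff ^^ i) u 0 - (fwd_diff ^^ i) u 1)"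
    unfolding moment_X_power Suc.IH fwd_diff_shift by (simp add: algebra_simps)
  also have "\<dots> = (-1) ^ Suc i * (fwd_diff ^^ Suc i) u 0"
    by (simp add: fwd_diff_def[of "(fwd_diff ^^ i) u"] algebra_simps)
  finally show ?case .
qed

definition Bernstein_poly :: "nat \<Rightarrow> nat \<Rightarrow> real poly" where
  "Bernstein_poly n k = smult (real (n choose k)) ([:0, 1:] ^ k * [:1, -1:] ^ (n - k))"

lemma poly_Bernstein_poly [simp]: "poly (Bernstein_poly n k) x = Bernstein n k x"
  by (simp add: Bernstein_poly_def Bernstein_def)

lemma moment_X_1_minus_X_power:
  "moment u ([:0, 1:] ^ k * [:1, -1:] ^ i) = (-1) ^ i * (fwd_diff ^^ i) u k"
  by (simp add: moment_X_power moment_1_minus_X_power fwd_diff_shift)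

lemma moment_Bernstein_poly:
  "moment u (Bernstein_poly n k) = real (n choose k) * ((-1) ^ (n - k) * (fwd_diff ^^ (n - k)) u k)"
  by (simp add: Bernstein_poly_def moment_smult moment_X_1_minus_X_power)

text \<open>Expanding \<open>X\<^sup>j = X\<^sup>j (X + (1 - X))\<^sup>N\<^sup>-\<^sup>j\<close> writes the monomial exactly in the Bernstein basis of
  degree \<open>N\<close>. Its \<open>k\<close>-th coefficient is this binomial quotient, which is close to \<open>(k / N)\<^sup>j\<close>, the
  value of the monomial at the \<open>k\<close>-th node.\<close>

lemma moment_as_Bernstein_sum:
  assumes "j \<le> N"
  shows "u j = (\<Sum>k\<le>N. real (k choose j) / real (N choose j) * moment u (Bernstein_poly N k))"
proof -
  define D where "D k = (-1) ^ (N - k) * (fwd_diff ^^ (N - k)) u k" for k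
  have "[:0, 1:] + [:1, -1:] = (1 :: real poly)"
    by (simp add: one_pCons)
  then have "([:0, 1:] :: real poly) ^ j = [:0, 1:] ^ j * ([:0, 1:] + [:1, -1:]) ^ (N - j)"
    by (simp only: power_one mult_1_right)
  then have "([:0, 1:] :: real poly) ^ j = [:0, 1:] ^ j * (\<Sum>m\<le>N - j. of_nat (N - j choose m) * [:0, 1:] ^ m * [:1, -1:] ^ (N - j - m))"
    unfolding binomial_ring .
  also have "\<dots> = (\<Sum>m\<le>N - j. smult (of_nat (N - j choose m)) ([:0, 1:] ^ (j + m) * [:1, -1:] ^ (N - (j + m))))"
    by (simp add: sum_distrib_left power_add of_nat_poly mult_ac)
  finally have "moment u ([:0, 1:] ^ j) = (\<Sum>m\<le>N - j. real (N - j choose m) * D (j + m))"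
    by (simp add: moment_sum moment_smult moment_X_1_minus_X_power D_def)
  moreover have "moment u ([:0, 1:] ^ j) = u j"
    using moment_X_1_minus_X_power[of u j 0] by simp
  moreover have "(\<Sum>m\<le>N - j. real (N - j choose m) * D (j + m))
      = (\<Sum>k\<in>{j..N}. real (N - j choose (k - j)) * D k)"
    by (rule sum.reindex_bij_witness[of _ "\<lambda>k. k - j" "\<lambda>m. m + j"]) (use assms in \<open>auto simp: add_ac\<close>)
  moreover have "\<dots> = (\<Sum>k\<in>{j..N}. real (k choose j) / real (N choose j) * moment u (Bernstein_poly N k))"
  proof (rule sum.cong)
    fix k assume k: "k \<in> {j..N}"
    have "real (N choose k) * real (k choose j) = real (N choose j) * real (N - j choose (k - j))"
      using choose_mult[of j k N] k by (simp flip: of_nat_mult)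
    moreover have "N choose j \<noteq> 0" using assms by simp
    ultimately show "real (N - j choose (k - j)) * D k
        = real (k choose j) / real (N choose j) * moment u (Bernstein_poly N k)"
      unfolding moment_Bernstein_poly D_def by (simp add: field_simps del: binomial_eq_0_iff)
  qed simp
  moreover have "\<dots> = (\<Sum>k\<le>N. real (k choose j) / real (N choose j) * moment u (Bernstein_poly N k))"
    by (rule sum.mono_neutral_left) (auto simp: binomial_eq_0)
  ultimately show ?thesis by simp
qed

text \<open>The quotient is \<open>\<Prod>\<^sub>i\<^sub><\<^sub>j (k - i) / (N - i)\<close>, and each factor differs from \<open>k / N\<close> by at most
  \<open>j / (N - j)\<close>. All factors have absolute value at most \<open>1\<close>, also the negative ones for \<open>k < i\<close>, since
  \<open>2 j \<le> N\<close>; so the errors of the factors just add up.\<close>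

lemma binomial_ratio_approx:
  assumes "k \<le> N" "2 * j \<le> N" "N > 0"
  shows "\<bar>(real k / real N) ^ j - real (k choose j) / real (N choose j)\<bar>
           \<le> real j * (real j / (real N - real j))"
proof -
  have N: "real j < real N" using assms by linarith
  have ratio: "real (k choose j) / real (N choose j)
      = (\<Prod>i<j. (real k - real i) / (real N - real i))"
    by (simp add: binomial_gbinomial gbinomial_prod_rev prod_dividef atLeast0LessThan)
  have pos: "real N - real i > 0" if "i < j" for i using that N by linarith
  have "norm ((\<Prod>i<j. real k / real N) - (\<Prod>i<j. (real k - real i) / (real N - real i)))
      \<le> (\<Sum>i<j. norm (real k / real N - (real k - real i) / (real N - real i)))"
  proof (rule norm_prod_diff)
    fix i assume "i \<in> {..<j}"
    then have i: "i < j" by simp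
    show "norm (real k / real N) \<le> 1" using assms by simp
    show "norm ((real k - real i) / (real N - real i)) \<le> 1"
      using pos[OF i] i assms by (simp add: abs_le_iff)
  qed
  also have "\<dots> \<le> (\<Sum>i<j. real j / (real N - real j))"
  proof (rule sum_mono)
    fix i assume "i \<in> {..<j}"
    then have i: "i < j" by simp
    have "real k / real N - (real k - real i) / (real N - real i)
        = (real i / (real N - real i)) * ((real N - real k) / real N)"
      using pos[OF i] assms by (simp add: field_simps)
    also have "norm \<dots> \<le> real i / (real N - real i) * 1"
      unfolding norm_mult using pos[OF i] assms by (intro mult_mono) auto
    also have "\<dots> \<le> real j / (real N - real j)"
      using i N by (simp add: frac_le)
    finally show "norm (real k / real N - (real k - real i) / (real N - real i))
        \<le> real j / (real N - real j)" .
  qed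
  finally show ?thesis by (simp add: ratio)
qed

lemma Bernstein_sum_moment_tendsto:
  assumes C: "\<And>N. (\<Sum>k\<le>N. \<bar>moment u (Bernstein_poly N k)\<bar>) \<le> C"
  shows "(\<lambda>N. \<Sum>k\<le>N. (real k / real N) ^ j * moment u (Bernstein_poly N k)) \<longlonglongrightarrow> u j"
proof (rule LIM_zero_cancel, rule Lim_null_comparison)
  show "(\<lambda>N. C * (real j * (real j / (real N - real j)))) \<longlonglongrightarrow> 0" by real_asymp
  show "\<forall>\<^sub>F N in sequentially. norm ((\<Sum>k\<le>N. (real k / real N) ^ j * moment u (Bernstein_poly N k)) - u j)
      \<le> C * (real j * (real j / (real N - real j)))"
    using eventually_ge_at_top[of "2 * j + 1"]
  proof eventually_elim
    case (elim N)
    let ?m = "\<lambda>k. moment u (Bernstein_poly N k)"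
    let ?e = "real j * (real j / (real N - real j))"
    have "(\<Sum>k\<le>N. (real k / real N) ^ j * ?m k) - u j
      = (\<Sum>k\<le>N. ((real k / real N) ^ j - real (k choose j) / real (N choose j)) * ?m k)"
      using moment_as_Bernstein_sum[of j N u] elim by (simp add: sum_subtractf algebra_simps)
    also have "norm \<dots> \<le> (\<Sum>k\<le>N. ?e * \<bar>?m k\<bar>)"
      unfolding real_norm_def
      by (rule order_trans[OF sum_abs], rule sum_mono, unfold abs_mult,
          rule mult_right_mono[OF binomial_ratio_approx]) (use elim in auto)
    also have "\<dots> = ?e * (\<Sum>k\<le>N. \<bar>?m k\<bar>)" by (simp add: sum_distrib_left)
    also have "\<dots> \<le> ?e * C" by (rule mult_left_mono[OF C]) (use elim in auto)
    finally show ?case by (simp add: mult.commute)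
  qed
qed

text \<open>Hausdorff's argument. The weights \<open>moment u (Bernstein_poly N k)\<close> form a discrete signed measure on the
  nodes \<open>k / N\<close>, of total variation at most \<open>C\<close> by hypothesis. Integrating \<open>p\<close> against it gives at most
  \<open>C * B\<close> in absolute value, and these integrals converge to \<open>moment u p\<close> because they do so on
  monomials.\<close>

lemma bounded_moments_if_differences_bounded:
  assumes C: "\<And>N. (\<Sum>i\<le>N. real (N choose i) * \<bar>(fwd_diff ^^ i) u (N - i)\<bar>) \<le> C"
  shows "bounded_moments u"
  unfolding bounded_moments_def
proof (intro exI[of _ C] allI impI)
  fix p :: "real poly" and B :: real assume B: "\<forall>x\<in>{0..1}. \<bar>poly p x\<bar> \<le> B"
  let ?m = "\<lambda>N k. moment u (Bernstein_poly N k)"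
  have C': "(\<Sum>k\<le>N. \<bar>?m N k\<bar>) \<le> C" for N
  proof -
    have "(\<Sum>k\<le>N. \<bar>?m N k\<bar>) = (\<Sum>i\<le>N. real (N choose i) * \<bar>(fwd_diff ^^ i) u (N - i)\<bar>)"
      by (rule sum.reindex_bij_witness[of _ "\<lambda>i. N - i" "\<lambda>i. N - i"])
         (auto simp: moment_Bernstein_poly abs_mult binomial_symmetric[symmetric])
    with C show ?thesis by simp
  qed
  have "(\<lambda>N. \<Sum>j\<le>degree p. coeff p j * (\<Sum>k\<le>N. (real k / real N) ^ j * ?m N k))
      \<longlonglongrightarrow> (\<Sum>j\<le>degree p. coeff p j * u j)"
    by (intro tendsto_intros Bernstein_sum_moment_tendsto[OF C'])
  also have "(\<lambda>N. \<Sum>j\<le>degree p. coeff p j * (\<Sum>k\<le>N. (real k / real N) ^ j * ?m N k))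
      = (\<lambda>N. \<Sum>k\<le>N. poly p (real k / real N) * ?m N k)"
    by (subst sum_distrib_left, subst sum.swap)
       (simp add: poly_altdef sum_distrib_left sum_distrib_right mult_ac)
  finally have lim: "(\<lambda>N. \<Sum>k\<le>N. poly p (real k / real N) * ?m N k) \<longlonglongrightarrow> moment u p"
    by (simp add: moment_def)
  have B0: "0 \<le> B" using B[rule_format, of 0] by auto
  have "norm (\<Sum>k\<le>N. poly p (real k / real N) * ?m N k) \<le> C * B" for N
  proof -
    have "norm (\<Sum>k\<le>N. poly p (real k / real N) * ?m N k) \<le> (\<Sum>k\<le>N. B * \<bar>?m N k\<bar>)"
      unfolding real_norm_def
      by (rule order_trans[OF sum_abs], rule sum_mono, unfold abs_mult)
         (use B in \<open>auto intro!: mult_right_mono simp: divide_le_eq\<close>)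
    also have "\<dots> = B * (\<Sum>k\<le>N. \<bar>?m N k\<bar>)" by (simp add: sum_distrib_left)
    also have "\<dots> \<le> B * C" by (rule mult_left_mono[OF C' B0])
    finally show ?thesis by (simp add: mult.commute)
  qed
  then have "norm (moment u p) \<le> C * B"
    by (intro tendsto_upperbound[OF tendsto_norm[OF lim]]) auto
  then show "\<bar>moment u p\<bar> \<le> C * B" by simp
qed

text \<open>If \<open>u\<close> has the representing measure \<open>\<mu>\<close>, then the shifted sequence has \<open>x d\<mu>(x)\<close>.\<close>

lemma bounded_moments_shift:
  assumes "bounded_moments u"
  shows "bounded_moments (\<lambda>n. u (Suc n))"
proof -
  from assms obtain C where C: "C \<ge> 0"
    "\<And>p B. (\<And>x. x \<in> {0..1} \<Longrightarrow> \<bar>poly p x\<bar> \<le> B) \<Longrightarrow> \<bar>moment u p\<bar> \<le> C * B"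
    using bounded_momentsE by metis
  show ?thesis
    unfolding bounded_moments_def
  proof (intro exI[of _ C] allI impI)
    fix p :: "real poly" and B :: real assume B: "\<forall>x\<in>{0..1}. \<bar>poly p x\<bar> \<le> B"
    have "\<bar>moment u (pCons 0 p)\<bar> \<le> C * B"
    proof (rule C(2))
      fix x :: real assume x: "x \<in> {0..1}"
      then have "\<bar>x\<bar> * \<bar>poly p x\<bar> \<le> 1 * B" using B by (intro mult_mono) auto
      then show "\<bar>poly (pCons 0 p) x\<bar> \<le> B" by (simp add: abs_mult)
    qed
    then show "\<bar>moment (\<lambda>n. u (Suc n)) p\<bar> \<le> C * B" by (simp add: moment_pCons)
  qed
qed

text \<open>If \<open>u\<close> and \<open>v\<close> are represented by \<open>\<mu>\<close> and \<open>\<nu>\<close>, then \<open>u n * v n = \<integral>\<integral> (x y)\<^sup>n d\<mu>(x) d\<nu>(y)\<close>. So the functional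
  of \<open>v\<close> is applied in the variable \<open>y\<close> to \<open>p (x y)\<close>, which is bounded by \<open>B\<close>, and then the functional of
  \<open>u\<close> to the resulting polynomial \<open>q\<close> in \<open>x\<close>.\<close>

lemma bounded_moments_mult:
  assumes "bounded_moments u" "bounded_moments v"
  shows "bounded_moments (\<lambda>n. u n * v n)"
proof -
  from assms(1) obtain C where C: "C \<ge> 0"
    "\<And>p B. (\<And>x. x \<in> {0..1} \<Longrightarrow> \<bar>poly p x\<bar> \<le> B) \<Longrightarrow> \<bar>moment u p\<bar> \<le> C * B"
    using bounded_momentsE by metis
  from assms(2) obtain D where D: "D \<ge> 0"
    "\<And>p B. (\<And>x. x \<in> {0..1} \<Longrightarrow> \<bar>poly p x\<bar> \<le> B) \<Longrightarrow> \<bar>moment v p\<bar> \<le> D * B"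
    using bounded_momentsE by metis
  show ?thesis
    unfolding bounded_moments_def
  proof (intro exI[of _ "C * D"] allI impI)
    fix p :: "real poly" and B :: real assume B: "\<forall>x\<in>{0..1}. \<bar>poly p x\<bar> \<le> B"
    define q where "q = (\<Sum>j\<le>degree p. monom (coeff p j * v j) j)"
    have coeff_q: "coeff q j = (if j \<le> degree p then coeff p j * v j else 0)" for j
      by (simp add: q_def coeff_sum if_distrib sum.delta cong: if_cong)
    have deg_q: "degree q \<le> degree p"
      by (rule degree_le) (simp add: coeff_q)
    have "moment (\<lambda>n. u n * v n) p = moment u q"
      by (simp add: moment_altdef[OF deg_q] coeff_q) (simp add: moment_def mult_ac)
    moreover have "\<bar>moment u q\<bar> \<le> C * (D * B)"
    proof (rule C(2))
      fix x :: real assume x: "x \<in> {0..1}"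
      define r where "r = (\<Sum>j\<le>degree p. monom (coeff p j * x ^ j) j)"
      have coeff_r: "coeff r j = (if j \<le> degree p then coeff p j * x ^ j else 0)" for j
        by (simp add: r_def coeff_sum if_distrib sum.delta cong: if_cong)
      have deg_r: "degree r \<le> degree p"
        by (rule degree_le) (simp add: coeff_r)
      have "poly q x = moment v r"
        by (simp add: moment_altdef[OF deg_r] q_def poly_sum poly_monom coeff_r mult_ac)
      also have "\<bar>\<dots>\<bar> \<le> D * B"
      proof (rule D(2))
        fix y :: real assume "y \<in> {0..1}"
        with x have "y * x \<in> {0..1}" by (auto intro: mult_le_one)
        moreover have "poly r y = poly p (y * x)"
          by (simp add: r_def poly_sum poly_monom poly_altdef[of p] power_mult_distrib mult_ac)
        ultimately show "\<bar>poly r y\<bar> \<le> B" using B by metis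
      qed
      finally show "\<bar>poly q x\<bar> \<le> D * B" .
    qed
    ultimately show "\<bar>moment (\<lambda>n. u n * v n) p\<bar> \<le> C * D * B" by (simp add: mult.assoc)
  qed
qed

lemma has_bochner_integral_exp_powr:
  fixes s c :: real
  assumes s: "s > 0" and c: "c > 0"
  shows "has_bochner_integral lborel (\<lambda>t. indicator {0..} t * (t powr (s - 1) * exp (- (c * t))))
           (Gamma s * c powr (- s))"
proof -
  have 1: "has_bochner_integral lborel (\<lambda>t. indicator {0..} t * t powr (s - 1) / exp t) (Gamma s)"
    using Gamma_conv_nn_integral_real[OF s] Gamma_real_pos[OF s]
    by (intro has_bochner_integral_nn_integral) auto
  have "has_bochner_integral lborel
      (\<lambda>t. indicator {0..} (0 + c * t) * (0 + c * t) powr (s - 1) / exp (0 + c * t)) (Gamma s /\<^sub>R \<bar>c\<bar>)"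
    using lborel_has_bochner_integral_real_affine_iff
        [of c "\<lambda>t. indicator {0..} t * t powr (s - 1) / exp t" "Gamma s" 0] 1 c by simp
  then have "has_bochner_integral lborel
      (\<lambda>t. c powr (1 - s) * (indicator {0..} (0 + c * t) * (0 + c * t) powr (s - 1) / exp (0 + c * t)))
      (c powr (1 - s) * (Gamma s /\<^sub>R \<bar>c\<bar>))"
    by (intro has_bochner_integral_mult_right) auto
  also have "(\<lambda>t. c powr (1 - s) * (indicator {0..} (0 + c * t) * (0 + c * t) powr (s - 1) / exp (0 + c * t)))
      = (\<lambda>t. indicator {0..} t * (t powr (s - 1) * exp (- (c * t))))"
  proof
    fix t :: real
    have "c powr (1 - s) * c powr (s - 1) = 1"
      using c by (simp add: powr_add[symmetric])
    then show "c powr (1 - s) * (indicator {0..} (0 + c * t) * (0 + c * t) powr (s - 1) / exp (0 + c * t))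
        = indicator {0..} t * (t powr (s - 1) * exp (- (c * t)))"
      using c by (cases "t \<ge> 0") (simp_all add: powr_mult exp_minus field_simps zero_le_mult_iff)
  qed
  also have "c powr (1 - s) * (Gamma s /\<^sub>R \<bar>c\<bar>) = Gamma s * c powr (- s)"
    using c powr_add[of c 1 "-s"] by (simp add: field_simps)
  finally show ?thesis .
qed

text \<open>\<open>(n + 1)\<^sup>-\<^sup>s = 1 / \<Gamma>(s) \<integral> t\<^sup>s\<^sup>-\<^sup>1 e\<^sup>-\<^sup>t (e\<^sup>-\<^sup>t)\<^sup>n dt\<close> is the \<open>n\<close>-th moment of a probability measure in the
  variable \<open>x = e\<^sup>-\<^sup>t\<close>, so the functional has norm \<open>1\<close>.\<close>

lemma bounded_moments_powr:
  fixes s :: real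
  assumes s: "s > 0"
  shows "bounded_moments (\<lambda>n. real (Suc n) powr (- s))"
  unfolding bounded_moments_def
proof (intro exI[of _ 1] allI impI)
  fix p :: "real poly" and B :: real assume B: "\<forall>x\<in>{0..1}. \<bar>poly p x\<bar> \<le> B"
  let ?w = "\<lambda>c t. indicator {0..} t * (t powr (s - 1) * exp (- (c * t))) :: real"
  have "has_bochner_integral lborel (\<lambda>t. \<Sum>j\<le>degree p. coeff p j * ?w (real (Suc j)) t)
      (\<Sum>j\<le>degree p. coeff p j * (Gamma s * real (Suc j) powr (- s)))"
    by (intro has_bochner_integral_sum has_bochner_integral_mult_right has_bochner_integral_exp_powr s) auto
  also have "(\<lambda>t. \<Sum>j\<le>degree p. coeff p j * ?w (real (Suc j)) t) = (\<lambda>t. ?w 1 t * poly p (exp (- t)))"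
    by (simp add: poly_altdef sum_distrib_left exp_of_nat_mult[symmetric] mult_ac distrib_right exp_diff exp_minus fun_eq_iff field_simps exp_add)
  also have "(\<Sum>j\<le>degree p. coeff p j * (Gamma s * real (Suc j) powr (- s)))
      = Gamma s * moment (\<lambda>n. real (Suc n) powr (- s)) p"
    by (simp add: moment_def sum_distrib_left mult_ac)
  finally have 1: "has_bochner_integral lborel (\<lambda>t. ?w 1 t * poly p (exp (- t)))
      (Gamma s * moment (\<lambda>n. real (Suc n) powr (- s)) p)" .
  have 2: "has_bochner_integral lborel (\<lambda>t. ?w 1 t * B) (Gamma s * B)"
    using has_bochner_integral_exp_powr[OF s, of 1] by (intro has_bochner_integral_mult_left) auto
  have "norm (Gamma s * moment (\<lambda>n. real (Suc n) powr (- s)) p) \<le> Gamma s * B"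
    unfolding has_bochner_integral_integral_eq[OF 1, symmetric] has_bochner_integral_integral_eq[OF 2, symmetric]
  proof (rule Bochner_Integration.integral_norm_bound_integral)
    fix t :: real
    show "norm (?w 1 t * poly p (exp (- t))) \<le> ?w 1 t * B"
      using B by (cases "t \<ge> 0") (auto simp: abs_mult intro!: mult_left_mono)
  qed (use 1 2 in \<open>auto simp: has_bochner_integral_iff\<close>)
  then have "Gamma s * \<bar>moment (\<lambda>n. real (Suc n) powr (- s)) p\<bar> \<le> Gamma s * B"
    using Gamma_real_pos[OF s] by (simp add: abs_mult)
  then show "\<bar>moment (\<lambda>n. real (Suc n) powr (- s)) p\<bar> \<le> 1 * B"
    using Gamma_real_pos[OF s] by simp
qed

section \<open>Legendre polynomials and their weighted generating function\<close>

lemma map_poly_of_real_mult: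
  "map_poly complex_of_real (p * q) = map_poly complex_of_real p * map_poly complex_of_real q"
  by (rule poly_eqI) (simp add: coeff_map_poly coeff_mult)

lemma map_poly_of_real_power:
  "map_poly complex_of_real (p ^ n) = map_poly complex_of_real p ^ n"
  by (induction n) (simp_all add: map_poly_of_real_mult)

lemma map_poly_of_real_pderiv_funpow:
  "map_poly complex_of_real ((pderiv ^^ n) p) = (pderiv ^^ n) (map_poly complex_of_real p)"
proof (induction n)
  case (Suc n)
  have "map_poly complex_of_real (pderiv p) = pderiv (map_poly complex_of_real p)" for p
    by (rule poly_eqI) (simp add: coeff_map_poly coeff_pderiv)
  with Suc show ?case by simp
qed simp

lemma poly_map_poly_of_real:
  "poly (map_poly complex_of_real p) (complex_of_real x) = complex_of_real (poly p x)"
  by (induction p) (simp_all add: map_poly_pCons)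

lemma higher_deriv_poly: "(deriv ^^ n) (poly p) = poly ((pderiv ^^ n) p)" for p :: "complex poly"
proof (induction n)
  case (Suc n)
  have "deriv (poly p) = poly (pderiv p)" for p :: "complex poly"
    by (rule ext) (rule DERIV_imp_deriv, rule poly_DERIV)
  with Suc show ?case by simp
qed simp

text \<open>Rodrigues' formula makes \<open>P\<^sub>n(x)\<close> an \<open>n\<close>-th derivative, which Cauchy's formula turns into an
  integral over a circle about \<open>x\<close>. For the radius \<open>sqrt (1 - x\<^sup>2)\<close> the quotient
  \<open>(u\<^sup>2 - 1) / (2 (u - x))\<close> on the circle is exactly \<open>x + \<i> sqrt (1 - x\<^sup>2) sin (2 \<pi> t)\<close>.\<close>

lemma Legendre_poly_Laplace_integral:
  assumes x: "\<bar>x\<bar> < 1"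
  shows "((\<lambda>t. (complex_of_real x + \<i> * of_real (sqrt (1 - x\<^sup>2) * sin (2 * pi * t))) ^ n)
           has_integral complex_of_real (poly (Legendre_poly n) x)) {0..1}"
proof -
  define r where "r = sqrt (1 - x\<^sup>2)"
  have x2: "x\<^sup>2 < 1" using x by (simp add: abs_square_less_1)
  have r: "r > 0" "r\<^sup>2 = 1 - x\<^sup>2" using x2 by (auto simp: r_def)
  define q :: "complex poly" where "q = [:-1, 0, 1:] ^ n"
  have "map_poly complex_of_real ([:-1, 0, 1:] ^ n) = q"
    by (simp add: map_poly_of_real_power map_poly_pCons q_def)
  note q = this[symmetric]
  have deriv_q: "(deriv ^^ n) (poly q) (of_real x)
      = 2 ^ n * fact n * complex_of_real (poly (Legendre_poly n) x)"
    by (simp add: Legendre_poly_def higher_deriv_poly)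
       (simp only: q map_poly_of_real_pderiv_funpow[symmetric] poly_map_poly_of_real)
  have "((\<lambda>u. poly q u / (u - of_real x) ^ Suc n) has_contour_integral
      (2 * pi * \<i>) / fact n * (deriv ^^ n) (poly q) (of_real x)) (circlepath (of_real x) r)"
    by (rule Cauchy_has_contour_integral_higher_derivative_circlepath)
       (use r in \<open>auto intro!: continuous_intros holomorphic_intros\<close>)
  then have "((\<lambda>t. poly q (circlepath (of_real x) r t) / (circlepath (of_real x) r t - of_real x) ^ Suc n
        * vector_derivative (circlepath (of_real x) r) (at t within {0..1})) has_integral
      (2 * pi * \<i>) * (2 ^ n * complex_of_real (poly (Legendre_poly n) x))) {0..1}"
    unfolding has_contour_integral_def deriv_q by (simp add: mult_ac)
  then have "((\<lambda>t. (2 * pi * \<i>) * (2 ^ n * (complex_of_real x + \<i> * of_real (r * sin (2 * pi * t))) ^ n))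
      has_integral (2 * pi * \<i>) * (2 ^ n * complex_of_real (poly (Legendre_poly n) x))) {0..1}"
  proof (rule has_integral_eq[rotated])
    fix t :: real assume t: "t \<in> {0..1}"
    define e where "e = exp (2 * of_real pi * \<i> * of_real t)"
    have e0: "e \<noteq> 0" by (simp add: e_def)
    have sin_e: "2 * \<i> * of_real (sin (2 * pi * t)) = e - inverse e"
      by (simp add: sin_of_real[symmetric] sin_exp_eq e_def exp_minus mult_ac)
    have r2: "(of_real r)\<^sup>2 = (1 - (of_real x)\<^sup>2 :: complex)"
      using r(2) by (simp flip: of_real_power)
    have "(of_real x + of_real r * e)\<^sup>2 - 1 = 2 * of_real x * (of_real r * e) + (of_real r)\<^sup>2 * (e\<^sup>2 - 1)"
      by (simp add: r2 power2_sum power_mult_distrib algebra_simps)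
    then have "((of_real x + of_real r * e)\<^sup>2 - 1) / (of_real r * e)
        = (2 * of_real x * (of_real r * e) + (of_real r)\<^sup>2 * (e\<^sup>2 - 1)) / (of_real r * e)"
      by (rule arg_cong)
    also have "\<dots> = 2 * of_real x + of_real r * (e - inverse e)"
      using e0 r(1) by (simp add: field_simps power2_eq_square)
    also have "\<dots> = 2 * (of_real x + \<i> * of_real (r * sin (2 * pi * t)))"
      unfolding sin_e[symmetric] by (simp add: algebra_simps)
    finally have *: "((of_real x + of_real r * e)\<^sup>2 - 1) / (of_real r * e)
        = 2 * (of_real x + \<i> * of_real (r * sin (2 * pi * t)))" .
    have "poly q (circlepath (of_real x) r t) / (circlepath (of_real x) r t - of_real x) ^ Suc n
        * vector_derivative (circlepath (of_real x) r) (at t within {0..1})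
       = ((of_real x + of_real r * e)\<^sup>2 - 1) ^ n / (of_real r * e) ^ Suc n * (2 * pi * \<i> * (of_real r * e))"
    proof -
      have "circlepath (of_real x) r t = of_real x + of_real r * e"
        by (simp add: circlepath e_def)
      moreover have "vector_derivative (circlepath (of_real x) r) (at t within {0..1}) = 2 * pi * \<i> * r * e"
        using t by (simp only: vector_derivative_circlepath01 atLeastAtMost_iff e_def)
      moreover have "poly q u = (u\<^sup>2 - 1) ^ n" for u
        by (simp add: q_def poly_power power2_eq_square)
      ultimately show ?thesis by (simp add: mult_ac)
    qed
    also have "\<dots> = (2 * pi * \<i>) * (((of_real x + of_real r * e)\<^sup>2 - 1) / (of_real r * e)) ^ n"
      using e0 r by (simp add: power_divide)
    also have "\<dots> = (2 * pi * \<i>) * (2 ^ n * (complex_of_real x + \<i> * of_real (r * sin (2 * pi * t))) ^ n)"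
      unfolding * power_mult_distrib ..
    finally show "poly q (circlepath (of_real x) r t) / (circlepath (of_real x) r t - of_real x) ^ Suc n
        * vector_derivative (circlepath (of_real x) r) (at t within {0..1}) = \<dots>" .
  qed
  define K where "K = (2 * pi * \<i>) * 2 ^ n"
  have "K \<noteq> 0" by (simp add: K_def)
  have "((\<lambda>t. K * (complex_of_real x + \<i> * of_real (r * sin (2 * pi * t))) ^ n)
      has_integral K * complex_of_real (poly (Legendre_poly n) x)) {0..1}"
    unfolding K_def mult.assoc[of "2 * pi * \<i>"] by fact
  from has_integral_mult_right[OF this, of "inverse K"] show ?thesis
    unfolding r_def mult.assoc[symmetric] using \<open>K \<noteq> 0\<close> by simp
qed

text \<open>In the Laplace integral the base of the power lies in the closed unit disc.\<close>

lemma abs_Legendre_poly_le_1: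
  assumes "\<bar>x\<bar> < 1"
  shows "\<bar>poly (Legendre_poly n) x\<bar> \<le> 1"
proof -
  have "norm (complex_of_real (poly (Legendre_poly n) x)) \<le> 1 * measure lborel (cbox 0 (1 :: real))"
  proof (rule has_integral_bound)
    show "((\<lambda>t. (complex_of_real x + \<i> * of_real (sqrt (1 - x\<^sup>2) * sin (2 * pi * t))) ^ n)
           has_integral complex_of_real (poly (Legendre_poly n) x)) (cbox 0 1)"
      using Legendre_poly_Laplace_integral[OF assms] by simp
    fix t :: real
    have x2: "x\<^sup>2 < 1" using assms by (simp add: abs_square_less_1)
    have "x\<^sup>2 + (sqrt (1 - x\<^sup>2) * sin (2 * pi * t))\<^sup>2 = x\<^sup>2 + (1 - x\<^sup>2) * (sin (2 * pi * t))\<^sup>2"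
      using x2 by (simp add: power_mult_distrib)
    also have "\<dots> \<le> x\<^sup>2 + (1 - x\<^sup>2) * 1"
      using x2 by (intro add_left_mono mult_left_mono) (use assms in \<open>auto simp: abs_square_le_1\<close>)
    finally have "norm (complex_of_real x + \<i> * of_real (sqrt (1 - x\<^sup>2) * sin (2 * pi * t))) \<le> 1"
      by (simp add: cmod_def)
    then show "norm ((complex_of_real x + \<i> * of_real (sqrt (1 - x\<^sup>2) * sin (2 * pi * t))) ^ n) \<le> 1"
      by (simp add: norm_power power_le_one)
  qed simp
  then show ?thesis by simp
qed

lemma Legendre_poly_0: "Legendre_poly 0 = 1"
  by (simp add: Legendre_poly_def)

text \<open>Bonnet's recurrence. With \<open>w\<close> the base in the Laplace integral, the corresponding combination of
  powers of \<open>w\<close> is, up to the factor \<open>-2 \<pi>\<close>, the derivative of the periodic function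
  \<open>w\<^sup>n \<i> r cos (2 \<pi> t)\<close>, so its integral vanishes. For \<open>n = 0\<close> the truncated index \<open>n - 1\<close> is harmless,
  since it comes with the factor \<open>n\<close>.\<close>

lemma Legendre_poly_recurrence:
  assumes x: "\<bar>x\<bar> < 1"
  shows "real (n + 1) * poly (Legendre_poly (n + 1)) x + real n * poly (Legendre_poly (n - 1)) x
       = real (2 * n + 1) * x * poly (Legendre_poly n) x"
proof -
  define r where "r = sqrt (1 - x\<^sup>2)"
  have x2: "x\<^sup>2 < 1" using x by (simp add: abs_square_less_1)
  define r' where "r' = complex_of_real r"
  have r2: "r'\<^sup>2 = 1 - (of_real x)\<^sup>2"
    using x2 by (simp add: r'_def r_def flip: of_real_power)
  define w where "w t = complex_of_real x + \<i> * of_real (r * sin (2 * pi * t))" for t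
  define P where "P n = complex_of_real (poly (Legendre_poly n) x)" for n
  have P: "((\<lambda>t. w t ^ n) has_integral P n) {0..1}" for n
    unfolding w_def P_def r_def by (rule Legendre_poly_Laplace_integral[OF x])
  define D where "D t = of_nat (n + 1) * w t ^ (n + 1) + of_nat n * w t ^ (n - 1)
      - of_nat (2 * n + 1) * of_real x * w t ^ n" for t
  have 1: "(D has_integral of_nat (n + 1) * P (n + 1) + of_nat n * P (n - 1) - of_nat (2 * n + 1) * of_real x * P n) {0..1}"
    unfolding D_def by (intro has_integral_add has_integral_diff has_integral_mult_right P)
  define E where "E t = w t ^ n * (\<i> * of_real (r * cos (2 * pi * t)))" for t
  have "((\<lambda>t. (- 2 * pi) * D t) has_integral E 1 - E 0) {0..1}"
  proof (rule fundamental_theorem_of_calculus)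
    fix t :: real
    define s where "s = complex_of_real (sin (2 * pi * t))"
    define c where "c = complex_of_real (cos (2 * pi * t))"
    have sc: "c\<^sup>2 = 1 - s\<^sup>2"
      by (simp add: s_def c_def cos_squared_eq flip: of_real_power)
    have w_eq: "w t = of_real x + \<i> * (r' * s)" by (simp add: w_def r'_def s_def)
    have ident: "(\<i> * (r' * c))\<^sup>2 = 2 * of_real x * w t - 1 - (w t)\<^sup>2"
    proof -
      have "(\<i> * (r' * c))\<^sup>2 = - (r'\<^sup>2 * c\<^sup>2)" by (simp add: power_mult_distrib)
      also have "\<dots> = - r'\<^sup>2 + r'\<^sup>2 * s\<^sup>2" by (simp add: sc algebra_simps)
      also have "\<dots> = of_real x ^ 2 - 1 - (w t - of_real x)\<^sup>2"
        by (simp add: w_eq power_mult_distrib) (simp add: r2)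
      finally show ?thesis by (simp add: power2_eq_square algebra_simps)
    qed
    have "(E has_vector_derivative
        (of_nat n * w t ^ (n - 1) * (\<i> * (r' * (2 * pi * c)))) * (\<i> * (r' * c))
         + w t ^ n * (\<i> * (r' * (- 2 * pi * s)))) (at t within {0..1})"
    proof -
      define Ec where "Ec z = (of_real x + \<i> * (r' * sin (of_real (2 * pi) * z))) ^ n
          * (\<i> * (r' * cos (of_real (2 * pi) * z)))" for z
      have "E = (\<lambda>t. Ec (of_real t))"
        by (simp add: E_def Ec_def w_def r'_def fun_eq_iff sin_of_real[symmetric] cos_of_real[symmetric])
      moreover have "(Ec has_field_derivative
          (of_nat n * w t ^ (n - 1) * (\<i> * (r' * (2 * pi * c)))) * (\<i> * (r' * c))
           + w t ^ n * (\<i> * (r' * (- 2 * pi * s)))) (at (of_real t))"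
        unfolding Ec_def w_eq s_def c_def
        by (rule derivative_eq_intros refl)+
           (simp add: sin_of_real[symmetric] cos_of_real[symmetric] mult_ac)
      ultimately show ?thesis
        by (simp add: has_vector_derivative_real_field)
    qed
    also have "(of_nat n * w t ^ (n - 1) * (\<i> * (r' * (2 * pi * c)))) * (\<i> * (r' * c))
         + w t ^ n * (\<i> * (r' * (- 2 * pi * s)))
       = 2 * pi * (of_nat n * w t ^ (n - 1) * (\<i> * (r' * c))\<^sup>2 - w t ^ n * (w t - of_real x))"
      by (simp add: w_eq power2_eq_square algebra_simps)
    also have "\<dots> = (- 2 * pi) * D t"
      unfolding ident D_def by (cases n) (simp_all add: power2_eq_square algebra_simps)
    finally show "(E has_vector_derivative (- 2 * pi) * D t) (at t within {0..1})" .
  qed simp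
  then have "((\<lambda>t. (- 2 * pi) * D t) has_integral 0) {0..1}"
    by (simp add: E_def w_def)
  from has_integral_mult_right[OF this, of "1 / (- 2 * pi)"] have "(D has_integral 0) {0..1}"
    by simp
  with 1 have "of_nat (n + 1) * P (n + 1) + of_nat n * P (n - 1) - of_nat (2 * n + 1) * of_real x * P n = 0"
    by (rule has_integral_unique)
  then have "complex_of_real (real (n + 1) * poly (Legendre_poly (n + 1)) x + real n * poly (Legendre_poly (n - 1)) x)
     = complex_of_real (real (2 * n + 1) * x * poly (Legendre_poly n) x)"
    by (simp add: P_def)
  then show ?thesis unfolding of_real_eq_iff .
qed

lemma Legendre_radicand_pos:
  fixes x y :: real
  assumes "\<bar>x\<bar> < 1"
  shows "1 - 2 * x * y + y\<^sup>2 > 0"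
proof -
  have "1 - 2 * x * y + y\<^sup>2 = (1 - x\<^sup>2) + (x - y)\<^sup>2" by (simp add: power2_eq_square algebra_simps)
  moreover have "x\<^sup>2 < 1" using assms by (simp add: abs_square_less_1)
  ultimately show ?thesis by (simp only: add_pos_nonneg diff_gt_0_iff_gt zero_le_power2)
qed

text \<open>Bonnet's recurrence says that \<open>F y = \<Sum> P\<^sub>n(x) y\<^sup>n\<close> solves \<open>(1 - 2 x y + y\<^sup>2) F' = (x - y) F\<close>, hence
  \<open>F = 1 / sqrt (1 - 2 x y + y\<^sup>2)\<close>. The weights \<open>2 n + 1\<close> are produced by \<open>F + 2 y F'\<close>.\<close>

lemma Legendre_weighted_generating_function:
  assumes x: "\<bar>x\<bar> < 1" and y: "\<bar>y\<bar> < 1"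
  shows "(\<lambda>n. (2 * real n + 1) * poly (Legendre_poly n) x * y ^ n)
           sums ((1 - y\<^sup>2) / sqrt (1 - 2 * x * y + y\<^sup>2) ^ 3)"
proof -
  define c where "c n = poly (Legendre_poly n) x" for n
  have c_le: "\<bar>c n\<bar> \<le> 1" for n unfolding c_def by (rule abs_Legendre_poly_le_1[OF x])
  have sm: "summable (\<lambda>n. c n * y ^ n)" if "norm y < 1" for y :: real
  proof (rule summable_comparison_test')
    show "summable (\<lambda>n. norm y ^ n)" using that by (intro summable_geometric) auto
    show "norm (c n * y ^ n) \<le> norm y ^ n" for n
      using mult_right_mono[OF c_le, of "\<bar>y\<bar> ^ n" n] by (simp add: abs_mult power_abs)
  qed
  define F where "F y = (\<Sum>n. c n * y ^ n)" for y
  define F' where "F' y = (\<Sum>n. diffs c n * y ^ n)" for y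
  define g where "g y = 1 - 2 * x * y + y\<^sup>2" for y
  have g_pos: "g y > 0" for y
    unfolding g_def by (rule Legendre_radicand_pos[OF x])
  have F': "(F has_field_derivative F' y) (at y)" if "\<bar>y\<bar> < 1" for y
    unfolding F_def[abs_def] F'_def by (rule termdiffs_strong'[of 1]) (use sm that in auto)
  have s0: "(\<lambda>n. c n * y ^ n) sums F y" if "\<bar>y\<bar> < 1" for y
    unfolding F_def using sm[of y] that by (auto intro: summable_sums)
  have s1: "(\<lambda>n. real (Suc n) * c (Suc n) * y ^ n) sums F' y" if "\<bar>y\<bar> < 1" for y
  proof -
    have "summable (\<lambda>n. diffs c n * y ^ n)"
      by (rule termdiff_converges[of _ 1]) (use sm that in auto)
    then show ?thesis unfolding F'_def by (auto simp: diffs_def dest!: summable_sums)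
  qed
  have s1': "(\<lambda>n. real n * c n * y ^ n) sums (y * F' y)" if "\<bar>y\<bar> < 1" for y
    using sums_mult[OF s1[OF that], of y] sums_Suc_iff[of "\<lambda>n. real n * c n * y ^ n" "y * F' y"]
    by (simp add: mult_ac)
  have ode: "g y * F' y = (x - y) * F y" if y: "\<bar>y\<bar> < 1" for y
  proof -
    have "(\<lambda>n. y * (real n * c n * y ^ n + c n * y ^ n)) sums (y * (y * F' y + F y))"
      by (intro sums_mult sums_add s0 s1' y)
    then have s2: "(\<lambda>n. real n * c (n - 1) * y ^ n) sums (y * (y * F' y + F y))"
      using sums_Suc_iff[of "\<lambda>n. real n * c (n - 1) * y ^ n" "y * (y * F' y + F y)"]
      by (simp add: algebra_simps)
    have "(\<lambda>n. real (Suc n) * c (Suc n) * y ^ n - (2 * x * (real n * c n * y ^ n) + x * (c n * y ^ n))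
        + real n * c (n - 1) * y ^ n) sums (F' y - (2 * x * (y * F' y) + x * F y) + y * (y * F' y + F y))"
      by (intro sums_add sums_diff sums_mult s0 s1 s1' s2 y)
    moreover have zero: "real (Suc n) * c (Suc n) * y ^ n - (2 * x * (real n * c n * y ^ n) + x * (c n * y ^ n))
        + real n * c (n - 1) * y ^ n = 0" for n
    proof -
      have "real (Suc n) * c (Suc n) * y ^ n - (2 * x * (real n * c n * y ^ n) + x * (c n * y ^ n))
        + real n * c (n - 1) * y ^ n
        = ((real (n + 1) * c (n + 1) + real n * c (n - 1)) - real (2 * n + 1) * x * c n) * y ^ n"
        by (simp add: algebra_simps)
      then show ?thesis using Legendre_poly_recurrence[OF x, of n] by (simp add: c_def)
    qed
    ultimately have "F' y - (2 * x * (y * F' y) + x * F y) + y * (y * F' y + F y) = 0"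
      unfolding zero by (metis sums_unique2 sums_zero)
    then show ?thesis by (simp add: g_def power2_eq_square algebra_simps)
  qed
  have "F y * sqrt (g y) = F 0 * sqrt (g 0)"
  proof (rule has_field_derivative_zero_constant[of "{-1<..<1}" "\<lambda>y. F y * sqrt (g y)", THEN exE])
    fix t :: real assume t: "t \<in> {-1<..<1}"
    have dg: "(g has_field_derivative - 2 * (x - t)) (at t)"
      unfolding g_def by (auto intro!: derivative_eq_intros)
    have "((\<lambda>y. F y * sqrt (g y)) has_field_derivative
        F' t * sqrt (g t) + (inverse (sqrt (g t)) / 2) * (- 2 * (x - t)) * F t) (at t)"
      using t g_pos[of t]
      by (intro DERIV_mult F' DERIV_chain2[where f = sqrt and g = g] DERIV_real_sqrt dg) (auto simp: mult_ac)
    also have "F' t * sqrt (g t) + (inverse (sqrt (g t)) / 2) * (- 2 * (x - t)) * F t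
        = (g t * F' t - (x - t) * F t) / sqrt (g t)"
      using g_pos[of t] by (simp add: field_simps)
    also have "\<dots> = 0" using ode[of t] t by (simp add: abs_less_iff)
    finally show "((\<lambda>y. F y * sqrt (g y)) has_field_derivative 0) (at t within {-1<..<1})"
      by (rule has_field_derivative_at_within)
  next
    fix k assume "\<forall>y\<in>{-1<..<1}. F y * sqrt (g y) = k"
    then show ?thesis using y by (simp add: abs_less_iff)
  qed auto
  also have "F 0 = 1"
    by (simp add: F_def c_def powser_zero Legendre_poly_0)
  finally have F_eq: "F y = 1 / sqrt (g y)"
    using g_pos[of y] by (simp add: g_def[of 0] field_simps)
  have "(\<lambda>n. 2 * (real n * c n * y ^ n) + c n * y ^ n) sums (2 * (y * F' y) + F y)"
    by (intro sums_mult sums_add s0 s1' y)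
  also have "2 * (y * F' y) + F y = (2 * y * (x - y) + g y) * F y / g y"
  proof -
    have "g y * (2 * (y * F' y) + F y) = 2 * y * (g y * F' y) + g y * F y"
      by (simp add: algebra_simps)
    also have "\<dots> = (2 * y * (x - y) + g y) * F y"
      unfolding ode[OF y] by (simp add: algebra_simps)
    finally show ?thesis using g_pos[of y] by (simp add: eq_divide_eq mult.commute)
  qed
  also have "2 * y * (x - y) + g y = 1 - y\<^sup>2"
    by (simp add: g_def power2_eq_square algebra_simps)
  also have "(1 - y\<^sup>2) * F y / g y = (1 - y\<^sup>2) / sqrt (g y) ^ 3"
    using g_pos[of y] by (simp add: F_eq power3_eq_cube)
  finally show ?thesis
    by (simp add: c_def g_def algebra_simps)
qed

text \<open>The function \<open>((1 - y\<^sup>2) / w\<^sup>3 - 1) / y\<close> for \<open>w = sqrt (1 - 2 y z + y\<^sup>2)\<close>, that is, the weighted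
  generating function without its term of index \<open>0\<close>, divided by \<open>y\<close>. Writing \<open>1 - w\<close> as
  \<open>y (2 z - y) / (1 + w)\<close> removes the singularity at \<open>y = 0\<close>, and \<open>1 + w\<close> never vanishes because \<open>w\<close> is a
  principal root.\<close>

definition Legendre_kernel :: "real \<Rightarrow> complex \<Rightarrow> complex" where
  "Legendre_kernel y z =
     (let w = csqrt (1 - 2 * of_real y * z + (of_real y)\<^sup>2)
      in ((2 * z - of_real y) * (1 + w + w\<^sup>2) / (1 + w) - of_real y) / w ^ 3)"

lemma Legendre_kernel_sums:
  assumes x: "\<bar>x\<bar> < 1" and y: "0 \<le> y" "y < 1"
  shows "(\<lambda>n. (2 * real n + 3) * poly (Legendre_poly (Suc n)) x * y ^ n)
           sums Re (Legendre_kernel y (of_real x))"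
proof -
  define g where "g = 1 - 2 * x * y + y\<^sup>2"
  define w where "w = sqrt g"
  have g_pos: "g > 0"
    unfolding g_def by (rule Legendre_radicand_pos[OF x])
  then have w: "w > 0" "w\<^sup>2 = g" by (auto simp: w_def)
  have "csqrt (1 - 2 * of_real y * of_real x + (of_real y)\<^sup>2) = csqrt (of_real g)"
    by (simp add: g_def mult_ac)
  also have "\<dots> = of_real w"
    using g_pos by (simp add: csqrt_of_real_nonneg w_def)
  finally have "Legendre_kernel y (of_real x)
      = of_real (((2 * x - y) * (1 + w + w\<^sup>2) / (1 + w) - y) / w ^ 3)"
    by (simp add: Legendre_kernel_def Let_def)
  then have K: "Re (Legendre_kernel y (of_real x)) = ((2 * x - y) * (1 + w + w\<^sup>2) / (1 + w) - y) / w ^ 3"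
    by simp
  show ?thesis
  proof (cases "y = 0")
    case True
    have P1: "poly (Legendre_poly (Suc 0)) x = x"
      using Legendre_poly_recurrence[OF x, of 0] by (simp add: Legendre_poly_0)
    have "w = 1" using True by (simp add: w_def g_def)
    then have "Re (Legendre_kernel y (of_real x)) = 3 * x" using True K by simp
    then show ?thesis
      using True P1 powser_sums_zero[of "\<lambda>n. (2 * real n + 3) * poly (Legendre_poly (Suc n)) x"] by simp
  next
    case False
    have "y * Re (Legendre_kernel y (of_real x))
        = ((2 * x * y - y\<^sup>2) * (1 + w + w\<^sup>2) / (1 + w) - y\<^sup>2) / w ^ 3"
      unfolding K by (simp add: power2_eq_square algebra_simps)
    also have "2 * x * y - y\<^sup>2 = (1 - w) * (1 + w)"
      using w(2) by (simp add: g_def power2_eq_square algebra_simps)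
    also have "(1 - w) * (1 + w) * (1 + w + w\<^sup>2) / (1 + w) = (1 - w) * (1 + w + w\<^sup>2)"
      using w(1) by simp
    also have "\<dots> = 1 - w ^ 3"
      by (simp add: power2_eq_square power3_eq_cube algebra_simps)
    also have "(1 - w ^ 3 - y\<^sup>2) / w ^ 3 = (1 - y\<^sup>2) / w ^ 3 - 1"
      using w(1) by (simp add: diff_divide_distrib)
    finally have yK: "y * Re (Legendre_kernel y (of_real x)) = (1 - y\<^sup>2) / w ^ 3 - 1" .
    have "(\<lambda>n. (2 * real n + 1) * poly (Legendre_poly n) x * y ^ n) sums ((1 - y\<^sup>2) / w ^ 3)"
      unfolding w_def g_def by (rule Legendre_weighted_generating_function) (use x y in auto)
    then have "(\<lambda>n. (2 * real (Suc n) + 1) * poly (Legendre_poly (Suc n)) x * y ^ Suc n)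
        sums ((1 - y\<^sup>2) / w ^ 3 - 1)"
      by (subst sums_Suc_iff) (simp add: Legendre_poly_0)
    from sums_divide[OF this[folded yK], of y] False
    have "(\<lambda>n. (2 * real (Suc n) + 1) * poly (Legendre_poly (Suc n)) x * y ^ Suc n / y)
        sums Re (Legendre_kernel y (of_real x))" by simp
    also have "(\<lambda>n. (2 * real (Suc n) + 1) * poly (Legendre_poly (Suc n)) x * y ^ Suc n / y)
        = (\<lambda>n. (2 * real n + 3) * poly (Legendre_poly (Suc n)) x * y ^ n)"
      using False by (simp add: fun_eq_iff)
    finally show ?thesis .
  qed
qed

lemma Legendre_kernel_of_real:
  assumes "\<bar>x\<bar> < 1"
  shows "Legendre_kernel y (of_real x) \<in> \<real>"
proof -
  have g: "1 - 2 * x * y + y\<^sup>2 \<ge> 0" using Legendre_radicand_pos[OF assms, of y] by simp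
  have "csqrt (1 - 2 * of_real y * of_real x + (of_real y)\<^sup>2) = csqrt (of_real (1 - 2 * x * y + y\<^sup>2))"
    by (simp add: mult_ac)
  also have "\<dots> \<in> \<real>" using g by (simp only: csqrt_of_real_nonneg Re_complex_of_real Im_complex_of_real Reals_of_real)
  finally show ?thesis unfolding Legendre_kernel_def Let_def
    by (intro Reals_diff Reals_divide Reals_mult Reals_add Reals_power) auto
qed

text \<open>This is where the cut comes from: \<open>1 - 2 y z + y\<^sup>2 = s \<le> 0\<close> forces \<open>y > 0\<close> and
  \<open>z = (1 + y\<^sup>2 - s) / (2 y) \<ge> 1\<close>. Off the cut, the principal root is therefore holomorphic for every \<open>y \<ge> 0\<close>,
  in particular up to and including the end point \<open>y = 1\<close>.\<close>

lemma Legendre_kernel_radicand: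
  assumes z: "z \<notin> complex_of_real ` {1..}" and y: "0 \<le> y"
  shows "1 - 2 * of_real y * z + (of_real y)\<^sup>2 \<notin> \<real>\<^sub>\<le>\<^sub>0"
proof
  assume "1 - 2 * of_real y * z + (of_real y)\<^sup>2 \<in> \<real>\<^sub>\<le>\<^sub>0"
  then obtain s where s: "s \<le> 0" "1 - 2 * of_real y * z + (of_real y)\<^sup>2 = of_real s"
    by (auto elim!: nonpos_Reals_cases)
  have y0: "y \<noteq> 0"
  proof
    assume "y = 0"
    with s have "of_real s = (1 :: complex)" by simp
    with s(1) show False by simp
  qed
  have "z = (1 + (of_real y)\<^sup>2 - of_real s) / (2 * of_real y)"
    using y0 by (simp add: s(2)[symmetric] field_simps)
  then have "z = of_real ((1 + y\<^sup>2 - s) / (2 * y))" by simp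
  moreover have "(1 + y\<^sup>2 - s) / (2 * y) \<ge> 1"
    using s(1) y y0 sum_squares_bound[of 1 y] by (simp add: field_simps)
  ultimately show False using z by blast
qed

lemma csqrt_plus_1_nonzero: "1 + csqrt z \<noteq> 0"
proof
  assume "1 + csqrt z = 0"
  then have "Re (1 + csqrt z) = 0" by (simp only: zero_complex.sel)
  moreover have "Re (1 + csqrt z) = 1 + Re (csqrt z)" by (simp only: plus_complex.sel one_complex.sel)
  moreover have "Re (csqrt z) \<ge> 0" using csqrt_principal[of z] by linarith
  ultimately show False by linarith
qed

lemma continuous_on_Legendre_kernel:
  "continuous_on ({0..} \<times> (- complex_of_real ` {1..})) (\<lambda>(y, z). Legendre_kernel y z)"
proof -
  let ?D = "{0..} \<times> (- complex_of_real ` {1..})"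
  define r where "r p = 1 - 2 * of_real (fst p) * snd p + (of_real (fst p))\<^sup>2" for p :: "real \<times> complex"
  have r: "r p \<notin> \<real>\<^sub>\<le>\<^sub>0" if "p \<in> ?D" for p
    unfolding r_def by (rule Legendre_kernel_radicand) (use that in auto)
  have cont_r: "continuous_on ?D r"
    unfolding r_def by (intro continuous_intros)
  have root: "continuous_on ?D (\<lambda>p. csqrt (r p))"
    by (rule continuous_on_compose2[OF holomorphic_on_imp_continuous_on[OF holomorphic_on_csqrt] cont_r])
       (use r in blast)
  have nonzero: "csqrt (r p) ^ 3 \<noteq> 0" if "p \<in> ?D" for p
  proof -
    have "r p \<noteq> 0" using r[OF that] nonpos_Reals_zero_I by metis
    then show ?thesis by (simp only: power_eq_0_iff csqrt_eq_0 simp_thms)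
  qed
  show ?thesis
    unfolding Legendre_kernel_def Let_def split_def r_def[symmetric]
    by (intro continuous_intros root ballI csqrt_plus_1_nonzero nonzero)
qed

lemma holomorphic_Legendre_kernel:
  assumes y: "0 \<le> y"
  shows "Legendre_kernel y holomorphic_on (- complex_of_real ` {1..})"
proof -
  let ?D = "- complex_of_real ` {1..}"
  define r where "r z = 1 - 2 * of_real y * z + (of_real y)\<^sup>2" for z :: complex
  have r: "r z \<notin> \<real>\<^sub>\<le>\<^sub>0" if "z \<in> ?D" for z
    unfolding r_def by (rule Legendre_kernel_radicand) (use that y in auto)
  have root: "(\<lambda>z. csqrt (r z)) holomorphic_on ?D"
  proof (rule holomorphic_on_csqrt')
    show "r holomorphic_on ?D" unfolding r_def[abs_def] by (intro holomorphic_intros)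
  qed (rule r)
  have nonzero: "csqrt (r z) ^ 3 \<noteq> 0" if "z \<in> ?D" for z
  proof -
    have "r z \<noteq> 0" using r[OF that] nonpos_Reals_zero_I by metis
    then show ?thesis by (simp only: power_eq_0_iff csqrt_eq_0 simp_thms)
  qed
  show ?thesis
    unfolding Legendre_kernel_def[abs_def] Let_def r_def[symmetric]
    by (intro holomorphic_intros root csqrt_plus_1_nonzero nonzero)
qed

section \<open>Extending a moment functional to continuous functions\<close>

text \<open>For real \<open>h\<close> this is \<open>moment u\<close> of the Bernstein polynomial of \<open>h\<close>. The form as a finite sum of values
  of \<open>h\<close> also makes sense for complex \<open>h\<close> and is visibly holomorphic in parameters of \<open>h\<close>. Its limit for
  \<open>N \<rightarrow> \<infinity>\<close> plays the role of the integral of \<open>h\<close> against the representing measure.\<close>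

definition Bernstein_sum :: "(nat \<Rightarrow> real) \<Rightarrow> nat \<Rightarrow> (real \<Rightarrow> 'a) \<Rightarrow> 'a :: real_normed_vector" where
  "Bernstein_sum u N h = (\<Sum>k\<le>N. moment u (Bernstein_poly N k) *\<^sub>R h (real k / real N))"

text \<open>Test the functional on the Bernstein sum of the signs of the weights, which is bounded by \<open>1\<close>.\<close>

lemma Bernstein_weights_bounded:
  assumes "bounded_moments u"
  obtains C where "\<And>N. (\<Sum>k\<le>N. \<bar>moment u (Bernstein_poly N k)\<bar>) \<le> C"
proof -
  from assms obtain C where C: "C \<ge> 0"
    "\<And>p B. (\<And>x. x \<in> {0..1} \<Longrightarrow> \<bar>poly p x\<bar> \<le> B) \<Longrightarrow> \<bar>moment u p\<bar> \<le> C * B"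
    using bounded_momentsE by metis
  have "(\<Sum>k\<le>N. \<bar>moment u (Bernstein_poly N k)\<bar>) \<le> C" for N
  proof -
    define p where "p = (\<Sum>k\<le>N. smult (sgn (moment u (Bernstein_poly N k))) (Bernstein_poly N k))"
    have "\<bar>moment u p\<bar> \<le> C * 1"
    proof (rule C(2))
      fix x :: real assume x: "x \<in> {0..1}"
      have "\<bar>poly p x\<bar> \<le> (\<Sum>k\<le>N. \<bar>sgn (moment u (Bernstein_poly N k)) * Bernstein N k x\<bar>)"
        by (simp add: p_def poly_sum sum_abs)
      also have "\<dots> \<le> (\<Sum>k\<le>N. Bernstein N k x)"
        using x by (intro sum_mono) (auto simp: abs_mult Bernstein_nonneg abs_sgn_eq)
      finally show "\<bar>poly p x\<bar> \<le> 1" by simp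
    qed
    moreover have "moment u p = (\<Sum>k\<le>N. \<bar>moment u (Bernstein_poly N k)\<bar>)"
      by (simp add: p_def moment_sum moment_smult abs_sgn mult.commute)
    ultimately show ?thesis by simp
  qed
  with that show thesis by blast
qed

lemma Bernstein_sum_close_to_moment:
  fixes h :: "real \<Rightarrow> real"
  assumes C: "\<And>p B. (\<And>x. x \<in> {0..1} \<Longrightarrow> \<bar>poly p x\<bar> \<le> B) \<Longrightarrow> \<bar>moment u p\<bar> \<le> C * B"
    and h: "continuous_on {0..1} h" and e: "e > 0"
    and q: "\<And>x. x \<in> {0..1} \<Longrightarrow> \<bar>poly q x - h x\<bar> \<le> e"
  shows "\<forall>\<^sub>F N in sequentially. \<bar>Bernstein_sum u N h - moment u q\<bar> \<le> C * (2 * e)"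
proof -
  obtain N0 where N0: "\<And>N x. N \<ge> N0 \<Longrightarrow> x \<in> {0..1} \<Longrightarrow>
      \<bar>h x - (\<Sum>k\<le>N. h (real k / real N) * Bernstein N k x)\<bar> < e"
    using Bernstein_Weierstrass[OF h e] by blast
  have "\<bar>Bernstein_sum u N h - moment u q\<bar> \<le> C * (2 * e)" if "N \<ge> N0" for N
  proof -
    define B where "B = (\<Sum>k\<le>N. smult (h (real k / real N)) (Bernstein_poly N k))"
    have "\<bar>moment u (B - q)\<bar> \<le> C * (2 * e)"
    proof (rule C)
      fix x :: real assume x: "x \<in> {0..1}"
      show "\<bar>poly (B - q) x\<bar> \<le> 2 * e"
        using N0[OF that x] q[OF x] by (simp add: B_def poly_sum)
    qed
    moreover have "moment u B = Bernstein_sum u N h"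
      by (simp add: B_def Bernstein_sum_def moment_sum moment_smult mult.commute)
    ultimately show ?thesis by (simp add: moment_diff)
  qed
  then show ?thesis unfolding eventually_sequentially by blast
qed

text \<open>A Cauchy sequence: take \<open>q\<close> in the preceding lemma to be a Bernstein polynomial of \<open>h\<close> itself.\<close>

lemma Bernstein_sum_convergent_real:
  fixes h :: "real \<Rightarrow> real"
  assumes u: "bounded_moments u" and h: "continuous_on {0..1} h"
  shows "convergent (\<lambda>N. Bernstein_sum u N h)"
proof -
  from u obtain C where C: "C \<ge> 0"
    "\<And>p B. (\<And>x. x \<in> {0..1} \<Longrightarrow> \<bar>poly p x\<bar> \<le> B) \<Longrightarrow> \<bar>moment u p\<bar> \<le> C * B"
    using bounded_momentsE by metis
  have "Cauchy (\<lambda>N. Bernstein_sum u N h)"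
  proof (rule metric_CauchyI)
    fix e :: real assume e: "e > 0"
    define d where "d = e / (4 * C + 4)"
    have "d > 0" "d * (4 * C + 4) = e" using e C(1) by (auto simp: d_def intro!: divide_pos_pos)
    then have d: "d > 0" "4 * (C * d) < e" by (simp_all add: algebra_simps)
    obtain N0 where N0: "\<And>N x. N \<ge> N0 \<Longrightarrow> x \<in> {0..1} \<Longrightarrow>
        \<bar>h x - (\<Sum>k\<le>N. h (real k / real N) * Bernstein N k x)\<bar> < d"
      using Bernstein_Weierstrass[OF h d(1)] by blast
    define q where "q = (\<Sum>k\<le>N0. smult (h (real k / real N0)) (Bernstein_poly N0 k))"
    have "\<forall>\<^sub>F N in sequentially. \<bar>Bernstein_sum u N h - moment u q\<bar> \<le> C * (2 * d)"
    proof (rule Bernstein_sum_close_to_moment[OF C(2) h d(1)])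
      fix x :: real assume "x \<in> {0..1}"
      from N0[OF order_refl this] show "\<bar>poly q x - h x\<bar> \<le> d"
        by (simp add: q_def poly_sum)
    qed
    then obtain M where M: "\<And>N. N \<ge> M \<Longrightarrow> \<bar>Bernstein_sum u N h - moment u q\<bar> \<le> C * (2 * d)"
      unfolding eventually_sequentially by blast
    show "\<exists>M. \<forall>m\<ge>M. \<forall>n\<ge>M. dist (Bernstein_sum u m h) (Bernstein_sum u n h) < e"
    proof (intro exI[of _ M] allI impI)
      fix m n assume "m \<ge> M" "n \<ge> M"
      with M[of m] M[of n] d(2) show "dist (Bernstein_sum u m h) (Bernstein_sum u n h) < e"
        by (simp add: dist_real_def)
    qed
  qed
  then show ?thesis by (rule Cauchy_convergent)
qed

lemma Bernstein_sum_convergent: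
  fixes h :: "real \<Rightarrow> complex"
  assumes u: "bounded_moments u" and h: "continuous_on {0..1} h"
  shows "convergent (\<lambda>N. Bernstein_sum u N h)"
proof -
  have "convergent (\<lambda>N. Bernstein_sum u N (\<lambda>x. Re (h x)))" "convergent (\<lambda>N. Bernstein_sum u N (\<lambda>x. Im (h x)))"
    by (intro Bernstein_sum_convergent_real u continuous_intros h)+
  then obtain a b where
    "(\<lambda>N. Bernstein_sum u N (\<lambda>x. Re (h x))) \<longlonglongrightarrow> a" "(\<lambda>N. Bernstein_sum u N (\<lambda>x. Im (h x))) \<longlonglongrightarrow> b"
    unfolding convergent_def by blast
  then have "(\<lambda>N. Bernstein_sum u N h) \<longlonglongrightarrow> Complex a b"
    by (simp add: tendsto_complex_iff Bernstein_sum_def)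
  then show ?thesis by (rule convergentI)
qed

text \<open>The power series need not converge uniformly up to \<open>y = 1\<close>, so it cannot be integrated termwise
  directly. Dilation helps: for \<open>s < 1\<close> close to \<open>1\<close>, \<open>h (s y)\<close> is uniformly close to \<open>h y\<close>, while
  its power series converges uniformly on the unit interval. The moments of its partial sums are close to
  \<open>\<Sum> d\<^sub>n u\<^sub>n s\<^sup>n\<close>, which tends to \<open>\<Sum> d\<^sub>n u\<^sub>n\<close> for \<open>s \<rightarrow> 1\<close> thanks to the absolute summability.\<close>

lemma Bernstein_sum_power_series_tendsto:
  fixes h :: "real \<Rightarrow> real"
  assumes u: "bounded_moments u" and h: "continuous_on {0..1} h"
    and d: "\<And>y. 0 \<le> y \<Longrightarrow> y < 1 \<Longrightarrow> (\<lambda>n. d n * y ^ n) sums h y"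
    and du: "summable (\<lambda>n. \<bar>d n * u n\<bar>)"
  shows "(\<lambda>N. Bernstein_sum u N h) \<longlonglongrightarrow> (\<Sum>n. d n * u n)"
proof (rule LIMSEQ_I)
  fix e :: real assume e: "e > 0"
  from u obtain C where C: "C \<ge> 0"
    "\<And>p B. (\<And>x. x \<in> {0..1} \<Longrightarrow> \<bar>poly p x\<bar> \<le> B) \<Longrightarrow> \<bar>moment u p\<bar> \<le> C * B"
    using bounded_momentsE by metis
  define \<delta> where "\<delta> = e / (2 * C + 2)"
  have "\<delta> > 0" "\<delta> * (2 * C + 2) = e"
    using e C(1) by (auto simp: \<delta>_def intro!: divide_pos_pos)
  then have \<delta>: "\<delta> > 0" "C * (2 * \<delta>) + \<delta> < e"
    by (simp_all add: algebra_simps)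
  define A where "A s = (\<Sum>n. d n * u n * s ^ n)" for s :: real
  have unif: "uniform_limit {0..1} (\<lambda>m s. \<Sum>n<m. d n * u n * s ^ n) A sequentially"
    unfolding A_def
  proof (rule Weierstrass_m_test[OF _ du])
    fix n and s :: real assume "s \<in> {0..1}"
    then have "\<bar>d n * u n\<bar> * \<bar>s ^ n\<bar> \<le> \<bar>d n * u n\<bar> * 1"
      by (intro mult_left_mono) (auto simp: power_abs power_le_one)
    then show "norm (d n * u n * s ^ n) \<le> \<bar>d n * u n\<bar>" by (simp add: abs_mult)
  qed
  have "continuous_on {0..1} A"
    by (rule uniform_limit_theorem[OF _ unif]) (auto intro!: always_eventually continuous_intros)
  then have "(A \<longlongrightarrow> A 1) (at 1 within {0..1})" by (auto simp: continuous_on_def)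
  then have "(A \<longlongrightarrow> A 1) (at_left 1)"
    by (simp add: at_within_Icc_at_left)
  then have ev1: "\<forall>\<^sub>F s in at_left 1. \<bar>A s - A 1\<bar> < \<delta> / 2"
    using \<delta>(1) by (auto dest!: tendstoD[of _ _ _ "\<delta> / 2"] simp: dist_real_def)
  have "uniformly_continuous_on {0..1} h"
    by (intro compact_uniformly_continuous h) auto
  then obtain \<eta> where \<eta>: "\<eta> > 0"
    "\<And>x y. x \<in> {0..1} \<Longrightarrow> y \<in> {0..1} \<Longrightarrow> dist x y < \<eta> \<Longrightarrow> dist (h x) (h y) < \<delta> / 2"
    unfolding uniformly_continuous_on_def using \<delta>(1) by (meson half_gt_zero)
  have ev2: "\<forall>\<^sub>F s in at_left (1 :: real). s > max 0 (1 - \<eta>)"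
    by (rule eventually_at_left_real[THEN eventually_mono, of "max 0 (1 - \<eta>)"]) (use \<eta>(1) in auto)
  have ev3: "\<forall>\<^sub>F s in at_left (1 :: real). s < 1"
    by (simp add: eventually_at_filter)
  obtain s where s: "\<bar>A s - A 1\<bar> < \<delta> / 2" "s > 0" "s > 1 - \<eta>" "s < 1"
    using eventually_happens'[OF _ eventually_conj[OF ev1 eventually_conj[OF ev2 ev3]]] by auto
  have "summable (\<lambda>n. d n * ((s + 1) / 2) ^ n)"
    by (rule sums_summable[OF d]) (use s in auto)
  then have sm: "summable (\<lambda>n. norm (d n * s ^ n))"
    by (rule powser_insidea) (use s in auto)
  define q where "q m = (\<Sum>n<m. monom (d n * s ^ n) n)" for m
  have "uniform_limit {0..1} (\<lambda>m y. \<Sum>n<m. d n * (s * y) ^ n) (\<lambda>y. \<Sum>n. d n * (s * y) ^ n) sequentially"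
  proof (rule Weierstrass_m_test[OF _ sm])
    fix n and y :: real assume "y \<in> {0..1}"
    then have "\<bar>d n * s ^ n\<bar> * \<bar>y ^ n\<bar> \<le> \<bar>d n * s ^ n\<bar> * 1"
      by (intro mult_left_mono) (auto simp: power_abs power_le_one)
    then show "norm (d n * (s * y) ^ n) \<le> norm (d n * s ^ n)"
      by (simp add: abs_mult power_mult_distrib mult_ac)
  qed
  from uniform_limitD[OF this, of "\<delta> / 2"] \<delta>(1)
  have "\<forall>\<^sub>F m in sequentially. \<forall>y\<in>{0..1}. dist (\<Sum>n<m. d n * (s * y) ^ n) (\<Sum>n. d n * (s * y) ^ n) < \<delta> / 2"
    by simp
  moreover have "\<forall>\<^sub>F m in sequentially. \<forall>t\<in>{0..1}. dist (\<Sum>n<m. d n * u n * t ^ n) (A t) < \<delta> / 2"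
    using uniform_limitD[OF unif, of "\<delta> / 2"] \<delta>(1) by simp
  ultimately have "\<exists>m. (\<forall>y\<in>{0..1}. dist (\<Sum>n<m. d n * (s * y) ^ n) (\<Sum>n. d n * (s * y) ^ n) < \<delta> / 2)
     \<and> (\<forall>t\<in>{0..1}. dist (\<Sum>n<m. d n * u n * t ^ n) (A t) < \<delta> / 2)"
    by (intro eventually_happens' eventually_conj) auto
  then obtain m where m: "\<And>y. y \<in> {0..1} \<Longrightarrow> dist (\<Sum>n<m. d n * (s * y) ^ n) (\<Sum>n. d n * (s * y) ^ n) < \<delta> / 2"
    "\<And>t. t \<in> {0..1} \<Longrightarrow> dist (\<Sum>n<m. d n * u n * t ^ n) (A t) < \<delta> / 2" by blast
  have "moment u (q m) = (\<Sum>n<m. d n * u n * s ^ n)"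
    by (simp add: q_def moment_sum moment_monom mult_ac)
  moreover have "dist (\<Sum>n<m. d n * u n * s ^ n) (A s) < \<delta> / 2"
    using s by (intro m(2)) auto
  ultimately have moment_q: "\<bar>moment u (q m) - A 1\<bar> < \<delta>"
    using s(1) unfolding dist_real_def by linarith
  have "\<forall>\<^sub>F N in sequentially. \<bar>Bernstein_sum u N h - moment u (q m)\<bar> \<le> C * (2 * \<delta>)"
  proof (rule Bernstein_sum_close_to_moment[OF C(2) h \<delta>(1)])
    fix y :: real assume y: "y \<in> {0..1}"
    have sy: "0 \<le> s * y" "s * y < 1" 
    proof -
      show "0 \<le> s * y" using s y by simp
      have "s * y \<le> s * 1" using s y by (intro mult_left_mono) auto
      then show "s * y < 1" using \<open>s < 1\<close> by linarith
    qed
    have "(\<Sum>n. d n * (s * y) ^ n) = h (s * y)"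
      using d[OF sy] by (simp add: sums_iff)
    moreover have "poly (q m) y = (\<Sum>n<m. d n * (s * y) ^ n)"
      by (simp add: q_def poly_sum poly_monom power_mult_distrib mult_ac)
    ultimately have "dist (poly (q m) y) (h (s * y)) < \<delta> / 2" using m(1)[OF y] by simp
    moreover have "dist (h (s * y)) (h y) < \<delta> / 2"
    proof (rule \<eta>(2))
      have "s * y - y = - ((1 - s) * y)" "0 \<le> (1 - s) * y"
        using s y by (auto simp: algebra_simps mult_left_le_one_le)
      then have "\<bar>s * y - y\<bar> = (1 - s) * y" by simp
      also have "\<dots> \<le> (1 - s) * 1" using s y by (intro mult_left_mono) auto
      finally show "dist (s * y) y < \<eta>" using s by (simp add: dist_real_def)
    qed (use y sy in auto)
    ultimately show "\<bar>poly (q m) y - h y\<bar> \<le> \<delta>" unfolding dist_real_def by linarith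
  qed
  then obtain N0 where N0: "\<And>N. N \<ge> N0 \<Longrightarrow> \<bar>Bernstein_sum u N h - moment u (q m)\<bar> \<le> C * (2 * \<delta>)"
    unfolding eventually_sequentially by blast
  have A1: "A 1 = (\<Sum>n. d n * u n)" by (simp add: A_def)
  show "\<exists>N0. \<forall>N\<ge>N0. norm (Bernstein_sum u N h - (\<Sum>n. d n * u n)) < e"
  proof (intro exI[of _ N0] allI impI)
    fix N assume "N \<ge> N0"
    from N0[OF this] moment_q \<delta>(2) show "norm (Bernstein_sum u N h - (\<Sum>n. d n * u n)) < e"
      unfolding A1[symmetric] real_norm_def by linarith
  qed
qed

text \<open>The Bernstein sums converge pointwise in \<open>z\<close> and are bounded on compact sets, uniformly in \<open>N\<close>, by
  the bound on the weights. By Montel's theorem a subsequence converges to a holomorphic function, which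
  must be the pointwise limit of the whole sequence.\<close>

lemma Bernstein_sum_holomorphic_limit:
  fixes K :: "real \<Rightarrow> complex \<Rightarrow> complex"
  assumes u: "bounded_moments u" and S: "open S"
    and holo: "\<And>y. y \<in> {0..1} \<Longrightarrow> K y holomorphic_on S"
    and cont: "continuous_on ({0..1} \<times> S) (\<lambda>(y, z). K y z)"
  obtains G where "G holomorphic_on S"
    and "\<And>z. z \<in> S \<Longrightarrow> (\<lambda>N. Bernstein_sum u N (\<lambda>y. K y z)) \<longlonglongrightarrow> G z"
proof -
  define F where "F N z = Bernstein_sum u N (\<lambda>y. K y z)" for N z
  have conv: "convergent (\<lambda>N. F N z)" if "z \<in> S" for z
    unfolding F_def
  proof (rule Bernstein_sum_convergent[OF u])
    have "continuous_on {0..1} (\<lambda>y. (\<lambda>(y, z). K y z) (y, z))"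
      by (rule continuous_on_compose2[OF cont]) (use that in \<open>auto intro!: continuous_intros\<close>)
    then show "continuous_on {0..1} (\<lambda>y. K y z)" by simp
  qed
  obtain C where C: "\<And>N. (\<Sum>k\<le>N. \<bar>moment u (Bernstein_poly N k)\<bar>) \<le> C"
    using Bernstein_weights_bounded[OF u] by blast
  obtain G r where G: "G holomorphic_on S" "strict_mono (r :: nat \<Rightarrow> nat)"
    "\<And>z. z \<in> S \<Longrightarrow> ((\<lambda>n. F (r n) z) \<longlongrightarrow> G z) sequentially"
  proof (rule Montel[of S "range F" F])
    show "h holomorphic_on S" if "h \<in> range F" for h
    proof -
      from that obtain N where h: "h = F N" by blast
      show ?thesis
        unfolding h F_def[abs_def] Bernstein_sum_def scaleR_conv_of_real
        by (intro holomorphic_intros holo) (auto simp: divide_le_eq)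
    qed
  next
    fix X assume X: "compact X" "X \<subseteq> S"
    have "compact ((\<lambda>(y, z). K y z) ` ({0..1} \<times> X))"
      by (intro compact_continuous_image compact_Times continuous_on_subset[OF cont] X)
         (use X in auto)
    then obtain B where "\<forall>w\<in>(\<lambda>(y, z). K y z) ` ({0..1} \<times> X). norm w \<le> B"
      using compact_imp_bounded bounded_iff by metis
    then have B: "norm (K y z) \<le> B" if "y \<in> {0..1}" "z \<in> X" for y z
      using that by force
    have "norm (F N z) \<le> C * B" if z: "z \<in> X" for N z
    proof -
      have B0: "B \<ge> 0" using order_trans[OF norm_ge_zero B[of 0 z]] z by simp
      have "norm (F N z) \<le> (\<Sum>k\<le>N. \<bar>moment u (Bernstein_poly N k)\<bar> * B)"
        unfolding F_def Bernstein_sum_def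
        by (rule sum_norm_le) (auto intro!: mult_left_mono B z simp: divide_le_eq)
      also have "\<dots> = (\<Sum>k\<le>N. \<bar>moment u (Bernstein_poly N k)\<bar>) * B"
        by (simp add: sum_distrib_right)
      also have "\<dots> \<le> C * B" by (rule mult_right_mono[OF C B0])
      finally show ?thesis .
    qed
    then show "\<exists>B. \<forall>h\<in>range F. \<forall>z\<in>X. norm (h z) \<le> B" by blast
  qed (use S in auto)
  show thesis
  proof (rule that[OF G(1)])
    fix z assume z: "z \<in> S"
    then obtain l where l: "(\<lambda>N. F N z) \<longlonglongrightarrow> l" using conv unfolding convergent_def by blast
    with G(2) have "(\<lambda>n. F (r n) z) \<longlonglongrightarrow> l"
      by (auto dest: LIMSEQ_subseq_LIMSEQ simp: o_def)
    with G(3)[OF z] have "l = G z" by (rule LIMSEQ_unique[rotated])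
    with l show "(\<lambda>N. Bernstein_sum u N (\<lambda>y. K y z)) \<longlonglongrightarrow> G z" by (simp add: F_def)
  qed
qed

lemma real_analytic_on_Re_holomorphic:
  assumes G: "G holomorphic_on S" and S: "open S" and A: "complex_of_real ` A \<subseteq> S"
  shows "real_analytic_on (\<lambda>x. Re (G (of_real x))) A"
  unfolding real_analytic_on_def
proof
  fix x assume x: "x \<in> A"
  with A have "complex_of_real x \<in> S" by blast
  with S obtain r where r: "r > 0" "ball (complex_of_real x) r \<subseteq> S"
    by (auto simp: open_contains_ball)
  define c where "c n = (deriv ^^ n) G (of_real x) / fact n" for n
  have sums: "(\<lambda>n. Re (c n) * h ^ n) sums Re (G (of_real (x + h)))" if h: "\<bar>h\<bar> < r" for h
  proof -
    have "(\<lambda>n. c n * (of_real (x + h) - of_real x) ^ n) sums G (of_real (x + h))"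
      unfolding c_def
      by (rule holomorphic_power_series[OF holomorphic_on_subset[OF G r(2)]])
         (use h in \<open>simp add: dist_norm\<close>)
    then have "(\<lambda>n. Re (c n * of_real (h ^ n))) sums Re (G (of_real (x + h)))"
      by (intro sums_Re) simp
    then show ?thesis by simp
  qed
  have "(\<lambda>h. Re (G (of_real (x + h)))) has_fps_expansion Abs_fps (\<lambda>n. Re (c n))"
    unfolding has_fps_expansion_def
  proof
    have "summable (\<lambda>n. Re (c n) * (r / 2) ^ n)"
      by (rule sums_summable[OF sums]) (use r in auto)
    then have "ereal (norm (r / 2)) \<le> conv_radius (\<lambda>n. Re (c n))"
      by (rule conv_radius_geI)
    moreover have "0 < ereal (norm (r / 2))"
      using r by simp
    ultimately show "0 < fps_conv_radius (Abs_fps (\<lambda>n. Re (c n)))"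
      unfolding fps_conv_radius_def fps_nth_Abs_fps by (rule less_le_trans[rotated])
    have "eventually (\<lambda>h. h \<in> ball 0 r) (nhds (0 :: real))"
      using r by (intro eventually_nhds_in_open) auto
    then show "\<forall>\<^sub>F h in nhds 0. eval_fps (Abs_fps (\<lambda>n. Re (c n))) h = Re (G (of_real (x + h)))"
      by eventually_elim (use sums in \<open>auto simp: eval_fps_def sums_iff\<close>)
  qed
  then show "\<exists>F. (\<lambda>h. Re (G (of_real (x + h)))) has_fps_expansion F" by blast
qed

text \<open>Hoelder's inequality with a worse constant and an easier proof: apply
  \<open>t \<le> 1 + t\<^sup>q\<close> to \<open>t = (n + 1) l\<^sub>i\<close> and divide the sum over \<open>i\<close> by \<open>n + 1\<close>.\<close>

lemma sum_le_1_plus_power_sum: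
  fixes l :: "nat \<Rightarrow> real"
  assumes q: "q \<ge> 1" and l: "\<And>i. i \<le> n \<Longrightarrow> l i \<ge> 0"
    and M: "real (n + 1) powr (q - 1) * (\<Sum>i\<le>n. l i powr q) \<le> M"
  shows "(\<Sum>i\<le>n. l i) \<le> 1 + M"
proof -
  have le: "t \<le> 1 + t powr q" if "t \<ge> 0" for t :: real
  proof (cases "t \<le> 1")
    case False
    then have "t powr 1 \<le> t powr q" using q by (intro powr_mono) auto
    then show ?thesis using False by simp
  qed (simp add: add_increasing2)
  have "real (n + 1) * (\<Sum>i\<le>n. l i) \<le> (\<Sum>i\<le>n. 1 + (real (n + 1) * l i) powr q)"
    unfolding sum_distrib_left by (intro sum_mono le) (use l in auto)
  also have "\<dots> = real (n + 1) + real (n + 1) powr q * (\<Sum>i\<le>n. l i powr q)"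
    using l by (simp add: sum.distrib powr_mult sum_distrib_left)
  also have "real (n + 1) powr q = real (n + 1) * real (n + 1) powr (q - 1)"
    by (simp add: powr_diff)
  also have "real (n + 1) + real (n + 1) * real (n + 1) powr (q - 1) * (\<Sum>i\<le>n. l i powr q)
      \<le> real (n + 1) + real (n + 1) * M"
    using M by (simp add: mult.assoc)
  also have "\<dots> = real (n + 1) * (1 + M)" by (simp add: algebra_simps)
  finally show ?thesis by (simp only: mult_le_cancel_left_pos of_nat_0_less_iff)
qed

section \<open>Convergence and continuation of the Legendre series\<close>

text \<open>The hypothesis on \<open>f\<close> gives \<open>\<bar>f n\<bar> \<le> c n\<^sup>-\<^sup>s\<close> with \<open>s = (q - 1) / q > 0\<close>, so the terms are
  \<open>O(n\<^sup>1\<^sup>-\<^sup>p\<^sup>-\<^sup>s)\<close>, and \<open>1 - p - s < -1\<close>. The gain \<open>s\<close> is what saves the border case \<open>p = 2\<close>.\<close>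

lemma summable_coefficients:
  fixes a f :: "nat \<Rightarrow> real" and p q M :: real
  assumes p: "p \<ge> 2" and q: "q > 1" and f: "\<And>n. f n = real n powr p * a n"
    and M: "\<And>n. real (n + 1) powr (q - 1) * \<bar>f n\<bar> powr q \<le> M"
  shows "summable (\<lambda>n. (2 * real n + 1) * \<bar>a n\<bar>)"
proof (rule summable_comparison_test_ev)
  have M0: "M \<ge> 0" using order_trans[OF _ M[of 0]] by simp
  define s where "s = (q - 1) / q"
  have s: "s > 0" using q by (simp add: s_def)
  show "summable (\<lambda>n. 3 * M powr (1 / q) * real n powr (- 1 - s))"
    using s by (intro summable_mult) (simp add: summable_real_powr_iff)
  show "\<forall>\<^sub>F n in sequentially. norm ((2 * real n + 1) * \<bar>a n\<bar>) \<le> 3 * M powr (1 / q) * real n powr (- 1 - s)"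
    using eventually_gt_at_top[of 0]
  proof eventually_elim
    case (elim n)
    then have n: "real n \<ge> 1" by simp
    have "real n powr (q - 1) * \<bar>f n\<bar> powr q \<le> real (n + 1) powr (q - 1) * \<bar>f n\<bar> powr q"
      using q by (intro mult_right_mono powr_mono2) auto
    also have "\<dots> \<le> M" by (rule M)
    finally have "(real n powr (q - 1) * \<bar>f n\<bar> powr q) powr (1 / q) \<le> M powr (1 / q)"
      using q by (intro powr_mono2) auto
    then have 1: "real n powr s * \<bar>f n\<bar> \<le> M powr (1 / q)"
      using q by (simp add: powr_mult powr_powr s_def)
    have "\<bar>f n\<bar> = real n powr p * \<bar>a n\<bar>" by (simp add: f abs_mult)
    then have "real n powr (s + p) * \<bar>a n\<bar> \<le> M powr (1 / q)"
      using 1 by (simp add: powr_add mult_ac)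
    then have "\<bar>a n\<bar> \<le> M powr (1 / q) * real n powr (- (s + p))"
      using n unfolding powr_minus by (simp add: divide_simps mult_ac)
    also have "\<dots> \<le> M powr (1 / q) * real n powr (- 2 - s)"
      using n p by (intro mult_left_mono powr_mono) auto
    finally have "(2 * real n + 1) * \<bar>a n\<bar> \<le> (3 * real n) * (M powr (1 / q) * real n powr (- 2 - s))"
      using n by (intro mult_mono) auto
    also have "\<dots> = 3 * M powr (1 / q) * real n powr (- 1 - s)"
      using n powr_add[of "real n" 1 "- 2 - s"] by simp
    finally show ?case by simp
  qed
qed

theorem proposition7:
  fixes p :: real and a f :: "nat \<Rightarrow> real"
  assumes p: "p \<ge> 2"
    and f: "\<And>n. f n = real n powr p * a n"
    and hausdorff: "\<exists>M>0. \<exists>\<epsilon>>0. \<forall>n.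
      real (n + 1) powr (1 + \<epsilon>) *
        (\<Sum>i=0..n. real (n choose i) powr (2 + \<epsilon>) * \<bar>(fwd_diff ^^ i) f (n - i)\<bar> powr (2 + \<epsilon>)) < M"
  shows "\<exists>g :: real \<Rightarrow> real.
      real_analytic_on g {-1<..<1} \<and>
      (\<forall>u0 :: real. \<bar>cos u0\<bar> < 1 \<longrightarrow>
        uniform_limit {u :: real. \<bar>cos u\<bar> \<le> \<bar>cos u0\<bar>}
          (\<lambda>N u. 1 / (4 * pi) *
            (\<Sum>n<N. (2 * real n + 1) * a n * poly (Legendre_poly n) (cos u)))
          (\<lambda>u. g (cos u)) sequentially) \<and>
      (\<exists>G :: complex \<Rightarrow> complex.
        G holomorphic_on (- complex_of_real ` {1..}) \<and>
        (\<forall>u :: real. \<bar>cos u\<bar> < 1 \<longrightarrow> G (cos (complex_of_real u)) = complex_of_real (g (cos u))))"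
proof -
  from hausdorff obtain M \<epsilon> where "\<epsilon> > 0" and hyp: "\<And>n. real (n + 1) powr (1 + \<epsilon>) *
        (\<Sum>i=0..n. real (n choose i) powr (2 + \<epsilon>) * \<bar>(fwd_diff ^^ i) f (n - i)\<bar> powr (2 + \<epsilon>)) < M"
    by blast
  define q where "q = 2 + \<epsilon>"
  have q: "q > 1" "q - 1 = 1 + \<epsilon>" using \<open>\<epsilon> > 0\<close> by (simp_all add: q_def)
  define l where "l n i = real (n choose i) * \<bar>(fwd_diff ^^ i) f (n - i)\<bar>" for n i
  have M: "real (n + 1) powr (q - 1) * (\<Sum>i\<le>n. l n i powr q) \<le> M" for n
    using hyp[of n] by (simp add: l_def powr_mult q(2) q_def atLeast0AtMost)
  have "bounded_moments f"
  proof (rule bounded_moments_if_differences_bounded)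
    show "(\<Sum>i\<le>n. real (n choose i) * \<bar>(fwd_diff ^^ i) f (n - i)\<bar>) \<le> 1 + M" for n
      using sum_le_1_plus_power_sum[of q n "l n" M] M[of n] q(1) by (simp add: l_def)
  qed
  \<comment> \<open>The shift by one avoids the index \<open>0\<close>, at which \<open>f\<close> carries no information about \<open>a\<close>.\<close>
  then have "bounded_moments (\<lambda>n. f (Suc n) * real (Suc n) powr (- p))"
    by (intro bounded_moments_mult bounded_moments_shift bounded_moments_powr) (use p in auto)
  also have "(\<lambda>n. f (Suc n) * real (Suc n) powr (- p)) = (\<lambda>n. a (Suc n))"
    by (simp add: f powr_minus fun_eq_iff)
  finally have bm: "bounded_moments (\<lambda>n. a (Suc n))" .
  have summ: "summable (\<lambda>n. (2 * real n + 1) * \<bar>a n\<bar>)"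
  proof (rule summable_coefficients[OF p q(1) f])
    fix n
    \<comment> \<open>The summand of index \<open>0\<close> in the difference condition controls \<open>f n\<close> itself.\<close>
    have "\<bar>f n\<bar> powr q \<le> (\<Sum>i\<le>n. l n i powr q)"
      using member_le_sum[of 0 "{..n}" "\<lambda>i. l n i powr q"] by (simp add: l_def)
    then have "real (n + 1) powr (q - 1) * \<bar>f n\<bar> powr q \<le> real (n + 1) powr (q - 1) * (\<Sum>i\<le>n. l n i powr q)"
      by (intro mult_left_mono) auto
    also have "\<dots> \<le> M" by (rule M)
    finally show "real (n + 1) powr (q - 1) * \<bar>f n\<bar> powr q \<le> M" .
  qed
  let ?S = "- complex_of_real ` {1..}"
  have "closed (complex_of_real ` {1..})"
    by (intro closed_injective_linear_image) (auto simp: linear_of_real inj_of_real)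
  then have S: "open ?S" by (simp add: open_Compl)
  have interval: "complex_of_real ` {-1<..<1} \<subseteq> ?S" by auto
  obtain H where H: "H holomorphic_on ?S"
    "\<And>z. z \<in> ?S \<Longrightarrow> (\<lambda>N. Bernstein_sum (\<lambda>n. a (Suc n)) N (\<lambda>y. Legendre_kernel y z)) \<longlonglongrightarrow> H z"
  proof (rule Bernstein_sum_holomorphic_limit[OF bm S, of Legendre_kernel])
    show "Legendre_kernel y holomorphic_on ?S" if "y \<in> {0..1}" for y
      using that by (intro holomorphic_Legendre_kernel) auto
    show "continuous_on ({0..1} \<times> ?S) (\<lambda>(y, z). Legendre_kernel y z)"
      by (rule continuous_on_subset[OF continuous_on_Legendre_kernel]) auto
  qed (rule that)
  define T where "T x = (\<Sum>n. (2 * real n + 1) * a n * poly (Legendre_poly n) x)" for x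
  have term_le: "norm ((2 * real n + 1) * a n * poly (Legendre_poly n) x) \<le> (2 * real n + 1) * \<bar>a n\<bar>"
    if "\<bar>x\<bar> < 1" for n x
    using mult_left_mono[OF abs_Legendre_poly_le_1[OF that, of n], of "(2 * real n + 1) * \<bar>a n\<bar>"]
    by (simp add: abs_mult)
  have H_real: "of_real (a 0) + H (of_real x) = complex_of_real (T x)" if x: "\<bar>x\<bar> < 1" for x
  proof -
    define h where "h y = Re (Legendre_kernel y (of_real x))" for y
    define d where "d n = (2 * real n + 3) * poly (Legendre_poly (Suc n)) x" for n
    have xS: "of_real x \<in> ?S" using x interval by (auto simp: abs_less_iff)
    have kernel_h: "Legendre_kernel y (of_real x) = of_real (h y)" for y
      using Legendre_kernel_of_real[OF x, of y] by (simp add: h_def)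
    have h_cont: "continuous_on {0..1} h"
    proof -
      have "continuous_on {0..1} (\<lambda>y. (\<lambda>(y, z). Legendre_kernel y z) (y, of_real x))"
        by (rule continuous_on_compose2[OF continuous_on_Legendre_kernel])
           (use xS in \<open>auto intro!: continuous_intros\<close>)
      then show ?thesis unfolding h_def by (auto intro!: continuous_intros)
    qed
    have sumT: "summable (\<lambda>n. norm ((2 * real n + 1) * a n * poly (Legendre_poly n) x))"
      by (rule summable_comparison_test'[OF summ]) (use term_le[OF x] in simp)
    have d_eq: "d n * a (Suc n) = (2 * real (Suc n) + 1) * a (Suc n) * poly (Legendre_poly (Suc n)) x" for n
      by (simp add: d_def algebra_simps)
    have "(\<lambda>N. Bernstein_sum (\<lambda>n. a (Suc n)) N h) \<longlonglongrightarrow> (\<Sum>n. d n * a (Suc n))"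
    proof (rule Bernstein_sum_power_series_tendsto[OF bm h_cont])
      show "(\<lambda>n. d n * y ^ n) sums h y" if "0 \<le> y" "y < 1" for y
        unfolding d_def h_def by (rule Legendre_kernel_sums[OF x that])
      show "summable (\<lambda>n. \<bar>d n * a (Suc n)\<bar>)"
        unfolding d_eq using sumT
        by (subst summable_Suc_iff[of "\<lambda>n. \<bar>(2 * real n + 1) * a n * poly (Legendre_poly n) x\<bar>"]) simp
    qed
    then have "(\<lambda>N. complex_of_real (Bernstein_sum (\<lambda>n. a (Suc n)) N h)) \<longlonglongrightarrow> of_real (\<Sum>n. d n * a (Suc n))"
      by (rule tendsto_of_real)
    moreover have "complex_of_real (Bernstein_sum (\<lambda>n. a (Suc n)) N h)
        = Bernstein_sum (\<lambda>n. a (Suc n)) N (\<lambda>y. Legendre_kernel y (of_real x))" for N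
      by (simp add: Bernstein_sum_def kernel_h scaleR_conv_of_real)
    ultimately have "(\<lambda>N. Bernstein_sum (\<lambda>n. a (Suc n)) N (\<lambda>y. Legendre_kernel y (of_real x)))
        \<longlonglongrightarrow> of_real (\<Sum>n. d n * a (Suc n))"
      by simp
    with H(2)[OF xS] have "H (of_real x) = of_real (\<Sum>n. d n * a (Suc n))"
      by (rule LIMSEQ_unique)
    moreover have "T x = a 0 + (\<Sum>n. d n * a (Suc n))"
      unfolding T_def d_eq
      using suminf_split_head[OF summable_norm_cancel[OF sumT]] by (simp add: Legendre_poly_0)
    ultimately show ?thesis by simp
  qed
  define G where "G z = (of_real (a 0) + H z) / (4 * of_real pi)" for z
  define g where "g x = Re (G (of_real x))" for x
  have G: "G holomorphic_on ?S"
    unfolding G_def[abs_def] by (intro holomorphic_intros H(1)) auto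
  have G_real: "G (of_real x) = of_real (T x / (4 * pi))" if "\<bar>x\<bar> < 1" for x
    by (simp add: G_def H_real[OF that])
  then have g_eq: "g x = 1 / (4 * pi) * T x" if "\<bar>x\<bar> < 1" for x
    using that by (simp add: g_def)
  show ?thesis
  proof (intro exI[of _ g] conjI allI impI)
    show "real_analytic_on g {-1<..<1}"
      unfolding g_def[abs_def] by (rule real_analytic_on_Re_holomorphic[OF G S interval])
  next
    fix u0 :: real assume u0: "\<bar>cos u0\<bar> < 1"
    let ?U = "{u :: real. \<bar>cos u\<bar> \<le> \<bar>cos u0\<bar>}"
    have "uniform_limit ?U (\<lambda>N u. \<Sum>n<N. (2 * real n + 1) * a n * poly (Legendre_poly n) (cos u))
        (\<lambda>u. T (cos u)) sequentially"
      unfolding T_def by (rule Weierstrass_m_test[OF term_le summ]) (use u0 in auto)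
    then have "uniform_limit ?U (\<lambda>N u. 1 / (4 * pi) *
          (\<Sum>n<N. (2 * real n + 1) * a n * poly (Legendre_poly n) (cos u)))
        (\<lambda>u. 1 / (4 * pi) * T (cos u)) sequentially"
      by (rule bounded_linear_uniform_limit_intros(13))
    then show "uniform_limit ?U (\<lambda>N u. 1 / (4 * pi) *
          (\<Sum>n<N. (2 * real n + 1) * a n * poly (Legendre_poly n) (cos u)))
        (\<lambda>u. g (cos u)) sequentially"
      by (rule uniform_limit_cong'[THEN iffD1, rotated 2]) (use u0 g_eq in auto)
  next
    show "\<exists>G :: complex \<Rightarrow> complex. G holomorphic_on ?S \<and>
        (\<forall>u :: real. \<bar>cos u\<bar> < 1 \<longrightarrow> G (cos (complex_of_real u)) = complex_of_real (g (cos u)))"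
      using G by (intro exI[of _ G]) (simp add: cos_of_real G_real g_eq del: of_real_divide of_real_mult)
  qed
qed

end
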